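(* Let $(T(t))_{t\ge0}$ be a bounded $C_0$-semigroup on a complex Banach space $X$, with generator $A$. Furthermore, let $1\le p<\infty$ and $\beta>0$, and suppose that $T(\cdot)x\in L^p(0,\infty;X)$ for all $x\in D((-A)^\beta)$. Then $i\mathbb{R}\subseteq\rho(A)$ and $$\|T(t)A^{-1}\|=O\big(t^{-1/(p\beta)}\big),\qquad t\to\infty.$$ Moreover, if $X$ is a Hilbert space then $\|T(t)x\|=o(t^{-1/(p\beta)})$ as $t\to\infty$ for all $x\in D(A)$.
   Context: A $C_0$-semigroup $(T(t))_{t\ge0}$ is bounded if $\sup_{t\ge0}\|T(t)\|<\infty$. $D(A)$ and $\rho(A)$ denote the domain and the resolvent set of $A$. $(-A)^\beta$ is the usual fractional power of the sectorial operator $-A$; its domain $D((-A)^\beta)$ coincides with the range of the bounded injective operator $(I-A)^{-\beta}=\frac{1}{\Gamma(\beta)}\int_0^\infty t^{\beta-1}e^{-t}T(t)\,\mathrm{d}t$ (strong integral). *)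

theory Defs
  imports "HOL-Analysis.Analysis" "HOL-Library.Landau_Symbols"
begin

section \<open>Complex Banach and Hilbert spaces\<close>

class complex_banach = banach +
  fixes scaleC :: "complex \<Rightarrow> 'a \<Rightarrow> 'a" (infixr "*\<^sub>C" 75)
  assumes scaleC_add_right: "c *\<^sub>C (x + y) = c *\<^sub>C x + c *\<^sub>C y"
    and scaleC_add_left: "(c + d) *\<^sub>C x = c *\<^sub>C x + d *\<^sub>C x"
    and scaleC_scaleC: "c *\<^sub>C d *\<^sub>C x = (c * d) *\<^sub>C x"
    and scaleR_scaleC: "scaleR r x = complex_of_real r *\<^sub>C x"
    and norm_scaleC: "norm (c *\<^sub>C x) = cmod c * norm x"

instantiation complex :: complex_banach
begin

definition scaleC_complex :: "complex \<Rightarrow> complex \<Rightarrow> complex" where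
  "scaleC_complex c x = c * x"

instance
  by standard (auto simp: scaleC_complex_def algebra_simps scaleR_conv_of_real norm_mult)

end

definition bounded_clinear :: "('a::complex_banach \<Rightarrow> 'b::complex_banach) \<Rightarrow> bool" where
  "bounded_clinear f \<longleftrightarrow> bounded_linear f \<and> (\<forall>c x. f (c *\<^sub>C x) = c *\<^sub>C f x)"

definition complex_inner_product :: "('a::complex_banach \<Rightarrow> 'a \<Rightarrow> complex) \<Rightarrow> bool" where
  "complex_inner_product ip \<longleftrightarrow>
     (\<forall>x y z. ip (x + y) z = ip x z + ip y z) \<and>
     (\<forall>c x y. ip (c *\<^sub>C x) y = c * ip x y) \<and>
     (\<forall>x y. ip y x = cnj (ip x y)) \<and>
     (\<forall>x. x \<noteq> 0 \<longrightarrow> 0 < Re (ip x x))"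

text \<open>Completeness is part of the class, so being a Hilbert space only means that the given norm
  is induced by some inner product.\<close>

definition is_hilbert_space :: "'a::complex_banach itself \<Rightarrow> bool" where
  "is_hilbert_space _ \<longleftrightarrow>
     (\<exists>ip :: 'a \<Rightarrow> 'a \<Rightarrow> complex.
        complex_inner_product ip \<and> (\<forall>x. norm x = sqrt (Re (ip x x))))"


section \<open>Strongly continuous semigroups\<close>

text \<open>Only the values of \<open>T\<close> at nonnegative times are relevant throughout.\<close>

definition C0_semigroup :: "(real \<Rightarrow> 'a::complex_banach \<Rightarrow> 'a) \<Rightarrow> bool" where
  "C0_semigroup T \<longleftrightarrow>
     (\<forall>t\<ge>0. bounded_clinear (T t)) \<and>
     (\<forall>x. T 0 x = x) \<and>
     (\<forall>s\<ge>0. \<forall>t\<ge>0. \<forall>x. T (s + t) x = T s (T t x)) \<and>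
     (\<forall>x. continuous_on {0..} (\<lambda>t. T t x))"

definition bounded_semigroup :: "(real \<Rightarrow> 'a::complex_banach \<Rightarrow> 'a) \<Rightarrow> bool" where
  "bounded_semigroup T \<longleftrightarrow> bdd_above ((\<lambda>t. onorm (T t)) ` {0..})"

definition gen_domain :: "(real \<Rightarrow> 'a::complex_banach \<Rightarrow> 'a) \<Rightarrow> 'a set" where
  "gen_domain T = {x. \<exists>y. ((\<lambda>h. (T h x - x) /\<^sub>R h) \<longlongrightarrow> y) (at_right 0)}"

text \<open>The value of \<open>generator T\<close> is meaningful only on \<open>gen_domain T\<close>.\<close>

definition generator :: "(real \<Rightarrow> 'a::complex_banach \<Rightarrow> 'a) \<Rightarrow> 'a \<Rightarrow> 'a" where
  "generator T x = Lim (at_right 0) (\<lambda>h. (T h x - x) /\<^sub>R h)"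

definition resolvent_set :: "'a::complex_banach set \<Rightarrow> ('a \<Rightarrow> 'a) \<Rightarrow> complex set" where
  "resolvent_set D A =
     {z. bij_betw (\<lambda>x. z *\<^sub>C x - A x) D UNIV \<and>
         bounded_clinear (inv_into D (\<lambda>x. z *\<^sub>C x - A x))}"

text \<open>The operator \<open>(I - A)\<^bsup>-\<beta>\<^esup>\<close> for the generator \<open>A\<close> of the bounded semigroup \<open>T\<close>.
  The Henstock--Kurzweil integral is used because the library's Bochner integral requires
  a second countable codomain; the integrand is continuous and absolutely integrable on the
  open half-line, so the two notions give the same value.\<close>

definition neg_frac_power_shifted ::
  "(real \<Rightarrow> 'a::complex_banach \<Rightarrow> 'a) \<Rightarrow> real \<Rightarrow> 'a \<Rightarrow> 'a" where
  "neg_frac_power_shifted T \<beta> x =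
     integral {0<..} (\<lambda>t. (t powr (\<beta> - 1) * exp (- t)) *\<^sub>R T t x) /\<^sub>R Gamma \<beta>"

text \<open>The domain of \<open>(- A)\<^bsup>\<beta>\<^esup>\<close>, which for \<open>\<beta> > 0\<close> and bounded \<open>T\<close> is the domain of
  \<open>(I - A)\<^bsup>\<beta>\<^esup>\<close>, that is, the range of \<open>(I - A)\<^bsup>-\<beta>\<^esup>\<close>.\<close>

definition frac_power_domain :: "(real \<Rightarrow> 'a::complex_banach \<Rightarrow> 'a) \<Rightarrow> real \<Rightarrow> 'a set" where
  "frac_power_domain T \<beta> = range (neg_frac_power_shifted T \<beta>)"


section \<open>Vector-valued \<open>L\<^sup>p\<close> functions\<close>

text \<open>Strong (Bochner) measurability, which for nonseparable codomains is stronger than Borel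
  measurability.\<close>

definition strongly_measurable :: "'s measure \<Rightarrow> ('s \<Rightarrow> 'a::complex_banach) \<Rightarrow> bool" where
  "strongly_measurable M f \<longleftrightarrow>
     (\<exists>s. (\<forall>n. simple_function M (s n)) \<and> (AE t in M. (\<lambda>n::nat. s n t) \<longlonglongrightarrow> f t))"

definition in_Lp :: "real \<Rightarrow> 's measure \<Rightarrow> ('s \<Rightarrow> 'a::complex_banach) \<Rightarrow> bool" where
  "in_Lp p M f \<longleftrightarrow> strongly_measurable M f \<and> integrable M (\<lambda>t. norm (f t) powr p)"

end

theory Submission
  imports Defs
begin

text \<open>Write \<open>J\<^sub>a = (I - A)\<^bsup>-a\<^esup>\<close>. Since \<open>T\<close> is bounded, \<open>t \<parallel>T(t) J\<^sub>\<beta> x\<parallel>\<^sup>p\<close> is at most a constant times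
  the integral of \<open>\<parallel>T(s) J\<^sub>\<beta> x\<parallel>\<^sup>p\<close> over \<open>t/2 < s \<le> t\<close>, which is bounded and tends to zero; by uniform
  boundedness \<open>\<parallel>T(t) J\<^sub>\<beta>\<parallel> = O(t\<^bsup>-1/p\<^esup>)\<close>. The law \<open>J\<^sub>a J\<^sub>b = J\<^bsub>a+b\<^esub>\<close> gives
  \<open>\<parallel>T(t) J\<^bsub>n\<beta>\<^esub>\<parallel> = O(t\<^bsup>-n/p\<^esup>)\<close>, and for \<open>n\<beta> \<ge> 1\<close> the moment inequality
  \<open>\<parallel>J\<^sub>1 x\<parallel>\<^bsup>g\<^esup> \<le> C \<parallel>x\<parallel>\<^bsup>g-1\<^esup> \<parallel>J\<^sub>g x\<parallel>\<close> with \<open>g = n\<beta>\<close> turns this into the rate \<open>t\<^bsup>-1/(p\<beta>)\<^esup>\<close> for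
  \<open>T(t) J\<^sub>1\<close>, with \<open>o\<close> in place of \<open>O\<close> on every single vector. In particular
  \<open>\<parallel>T(t) J\<^sub>1\<parallel>\<close> tends to zero, so that \<open>is - A\<close> is invertible by a Neumann series.\<close>

text \<open>The law for \<open>J\<close> is a Fubini statement for orbits in an arbitrary Banach
  space. It is reduced to scalars: an orbit is replaced by its samples on a grid, scalar Tonelli
  applies to each of the finitely many cells, and the error is a real function integrated against
  the same kernels. For the moment inequality, splitting the density of \<open>J a\<close> works for
  0 < a < 1 only; there the splitting point is free and can be optimised. Composing with
  \<open>J d\<close> for steps d < 1 then reaches every exponent g \<ge> 1. Taking the root of order
  g = n \<beta> of t^(-n/p) gives t^(-1/(p \<beta>)) whatever n is. Of the n factors T(t/n)
  J_\<beta>, all but one are estimated in norm and the last stays on the vector; it is the one that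
  carries both the O and the o. The passage from J_1 to A^(-1) and D(A) rests on x = J_1 (x - A
  x).\<close>

section \<open>A dominated convergence theorem for Banach-valued integrals\<close>

text \<open>The triangle inequality through \<open>F\<close> bounds the distance of
  \<open>I j\<close> and \<open>I k\<close> by \<open>c j + c k\<close>; letting \<open>j\<close>
  tend to infinity leaves \<open>c k\<close>. Integrability of \<open>F\<close> is not touched here,
  and \<open>S\<close> is left general because the result serves both for boxes and for the whole
  space.\<close>

lemma has_integral_L1_limit_aux:
  fixes F :: "'n::euclidean_space \<Rightarrow> 'a::banach"
  assumes F: "\<And>k::nat. (Fk k has_integral I k) S"
    and h: "\<And>k. (h k has_integral c k) S"
    and le: "\<And>k u. u \<in> S \<Longrightarrow> norm (F u - Fk k u) \<le> h k u"
    and c: "c \<longlonglongrightarrow> 0"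
  obtains L where "I \<longlonglongrightarrow> L" "\<And>k. norm (L - I k) \<le> c k"
proof -
  have dist_le: "norm (I j - I k) \<le> c j + c k" for j k
  proof -
    have a: "((\<lambda>u. Fk j u - Fk k u) has_integral I j - I k) S"
      by (intro has_integral_diff F)
    have b: "((\<lambda>u. h j u + h k u) has_integral c j + c k) S"
      by (intro has_integral_add h)
    have d: "norm (Fk j u - Fk k u) \<le> h j u + h k u" if "u \<in> S" for u
      using le[OF that, of j] le[OF that, of k] norm_triangle_ineq4[of "F u - Fk k u" "F u - Fk j u"]
      by (simp add: algebra_simps)
    show ?thesis
      using integral_norm_bound_integral[of "\<lambda>u. Fk j u - Fk k u" S "\<lambda>u. h j u + h k u"]
        a b d by (simp add: has_integral_iff)
  qed
  have "Cauchy I"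
  proof (rule metric_CauchyI)
    fix e :: real assume "e > 0"
    then obtain N where N: "\<And>n. n \<ge> N \<Longrightarrow> norm (c n) < e / 2"
      using c LIMSEQ_D[of c 0 "e/2"] by auto
    have "dist (I m) (I n) < e" if "m \<ge> N" "n \<ge> N" for m n
      using dist_le[of m n] N[OF that(1)] N[OF that(2)] by (simp add: dist_norm)
    then show "\<exists>M. \<forall>m\<ge>M. \<forall>n\<ge>M. dist (I m) (I n) < e" by blast
  qed
  then obtain L where L: "I \<longlonglongrightarrow> L"
    using Cauchy_convergent convergent_def by blast
  have "norm (L - I k) \<le> c k" for k
  proof (rule LIMSEQ_le)
    show "(\<lambda>j. norm (I j - I k)) \<longlonglongrightarrow> norm (L - I k)"
      by (intro tendsto_intros L)
    show "(\<lambda>j. c j + c k) \<longlonglongrightarrow> c k"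
      using tendsto_add[OF c tendsto_const] by force
    show "\<exists>N. \<forall>n\<ge>N. norm (I n - I k) \<le> c n + c k"
      using dist_le by blast
  qed
  with L that show thesis by blast
qed

text \<open>On one and the same fine division the Riemann sums of \<open>F\<close> and
  \<open>Fk k\<close> differ by at most the Riemann sum of \<open>h k\<close>, which is close to
  \<open>c k\<close>. No measurability of \<open>F\<close> enters. Each of the four errors is kept
  below \<open>e / 4\<close>.\<close>

lemma has_integral_L1_limit_cbox:
  fixes F :: "'n::euclidean_space \<Rightarrow> 'a::banach"
  assumes F: "\<And>k::nat. (Fk k has_integral I k) (cbox a b)"
    and h: "\<And>k. (h k has_integral c k) (cbox a b)"
    and le: "\<And>k u. u \<in> cbox a b \<Longrightarrow> norm (F u - Fk k u) \<le> h k u"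
    and c: "c \<longlonglongrightarrow> 0" and I: "I \<longlonglongrightarrow> L"
  shows "(F has_integral L) (cbox a b)"
  unfolding has_integral
proof (intro allI impI)
  fix e :: real assume e: "e > 0"
  obtain k where k: "c k < e / 4" "norm (I k - L) < e / 4"
  proof -
    have "eventually (\<lambda>k. c k < e / 4) sequentially"
      using c e by (intro order_tendstoD) auto
    moreover have "eventually (\<lambda>k. dist (I k) L < e / 4) sequentially"
      using I e by (intro tendstoD) auto
    ultimately have "eventually (\<lambda>k. c k < e / 4 \<and> dist (I k) L < e / 4) sequentially"
      by (rule eventually_conj)
    then show thesis
      using that by (auto simp: dist_norm eventually_sequentially)
  qed
  obtain g1 where g1: "gauge g1"
    "\<And>D. D tagged_division_of (cbox a b) \<Longrightarrow> g1 fine D \<Longrightarrow>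
       norm ((\<Sum>(x, K)\<in>D. measure lborel K *\<^sub>R Fk k x) - I k) < e / 4"
    using F[of k, unfolded has_integral, rule_format, of "e / 4"] e by auto
  obtain g2 where g2: "gauge g2"
    "\<And>D. D tagged_division_of (cbox a b) \<Longrightarrow> g2 fine D \<Longrightarrow>
       norm ((\<Sum>(x, K)\<in>D. measure lborel K *\<^sub>R h k x) - c k) < e / 4"
    using h[of k, unfolded has_integral, rule_format, of "e / 4"] e by auto
  show "\<exists>g. gauge g \<and> (\<forall>D. D tagged_division_of cbox a b \<and> g fine D \<longrightarrow>
          norm ((\<Sum>(x, K)\<in>D. measure lborel K *\<^sub>R F x) - L) < e)"
  proof (intro exI[of _ "\<lambda>x. g1 x \<inter> g2 x"] conjI allI impI)
    show "gauge (\<lambda>x. g1 x \<inter> g2 x)" using g1 g2 by (simp add: gauge_Int)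
    fix D assume D: "D tagged_division_of cbox a b \<and> (\<lambda>x. g1 x \<inter> g2 x) fine D"
    then have f1: "g1 fine D" "g2 fine D" by (auto simp: fine_Int)
    have "norm ((\<Sum>(x, K)\<in>D. measure lborel K *\<^sub>R F x) - (\<Sum>(x, K)\<in>D. measure lborel K *\<^sub>R Fk k x))
        = norm (\<Sum>(x, K)\<in>D. measure lborel K *\<^sub>R (F x - Fk k x))"
      by (simp add: sum_subtractf scaleR_diff_right split_def)
    also have "\<dots> \<le> (\<Sum>(x, K)\<in>D. measure lborel K *\<^sub>R h k x)"
    proof (intro order.trans[OF norm_sum] sum_mono)
      fix z assume "z \<in> D"
      moreover obtain x K where z: "z = (x, K)" by (cases z)
      ultimately have "x \<in> cbox a b"
        using D tag_in_interval by blast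
      from le[OF this] show "norm (case z of (x, K) \<Rightarrow> measure lborel K *\<^sub>R (F x - Fk k x))
          \<le> (case z of (x, K) \<Rightarrow> measure lborel K *\<^sub>R h k x)"
        by (auto simp: z intro!: mult_left_mono)
    qed
    finally have a1: "norm ((\<Sum>(x, K)\<in>D. measure lborel K *\<^sub>R F x) - (\<Sum>(x, K)\<in>D. measure lborel K *\<^sub>R Fk k x))
        \<le> (\<Sum>(x, K)\<in>D. measure lborel K *\<^sub>R h k x)" .
    have a2: "\<bar>(\<Sum>(x, K)\<in>D. measure lborel K *\<^sub>R h k x) - c k\<bar> < e / 4"
      using g2(2)[of D] D f1 by simp
    have a3: "norm ((\<Sum>(x, K)\<in>D. measure lborel K *\<^sub>R Fk k x) - I k) < e / 4"
      using g1(2)[of D] D f1 by simp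
    define A where "A = (\<Sum>(x, K)\<in>D. measure lborel K *\<^sub>R F x)"
    define B where "B = (\<Sum>(x, K)\<in>D. measure lborel K *\<^sub>R Fk k x)"
    have "norm (A - L) \<le> norm (A - B) + norm (B - I k) + norm (I k - L)"
      using norm_triangle_ineq[of "A - B" "B - L"] norm_triangle_ineq[of "B - I k" "I k - L"] by simp
    then show "norm ((\<Sum>(x, K)\<in>D. measure lborel K *\<^sub>R F x) - L) < e"
      using a1 a2 a3 k unfolding A_def[symmetric] B_def[symmetric] by linarith
  qed
qed

text \<open>The Bochner integral of the library needs a second countable codomain; convergence in mean
  makes the Henstock--Kurzweil integral usable for an arbitrary Banach space.\<close>

theorem has_integral_L1_limit:
  fixes F :: "'n::euclidean_space \<Rightarrow> 'a::banach"
  assumes F: "\<And>k::nat. (Fk k has_integral I k) UNIV"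
    and h: "\<And>k. (h k has_integral c k) UNIV"
    and le: "\<And>k u. norm (F u - Fk k u) \<le> h k u"
    and c: "c \<longlonglongrightarrow> 0"
  obtains L where "(F has_integral L) UNIV" "I \<longlonglongrightarrow> L"
proof -
  obtain L where L: "I \<longlonglongrightarrow> L" "\<And>k. norm (L - I k) \<le> c k"
    by (rule has_integral_L1_limit_aux[OF F h le c]) (rule that)
  have h0: "0 \<le> h k u" for k u using order.trans[OF norm_ge_zero le] .
  have "(F has_integral L) UNIV"
  proof (subst has_integral', intro allI impI)
    fix e :: real assume e: "e > 0"
    obtain k where k: "c k < e / 3"
    proof -
      have "eventually (\<lambda>k. c k < e / 3) sequentially"
        using c e by (intro order_tendstoD) auto
      then show thesis
        using that by (auto simp: eventually_sequentially)
    qed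
    obtain B where B: "B > 0" "\<And>a b. ball 0 B \<subseteq> cbox a b \<Longrightarrow>
         \<exists>z. (Fk k has_integral z) (cbox a b) \<and> norm (z - I k) < e / 3"
      using has_integral'[THEN iffD1, OF F[of k], rule_format, of "e / 3"] e by auto
    have "\<exists>z. (F has_integral z) (cbox a b) \<and> norm (z - L) < e" if ab: "ball 0 B \<subseteq> cbox a b" for a b
    proof -
      have Fi: "(Fk j has_integral integral (cbox a b) (Fk j)) (cbox a b)" for j
        using F[of j] integrable_on_subcbox[of "Fk j" UNIV a b] by (auto simp: integrable_integral)
      have hi: "(h j has_integral integral (cbox a b) (h j)) (cbox a b)" for j
        using h[of j] integrable_on_subcbox[of "h j" UNIV a b] by (auto simp: integrable_integral)
      \<comment> \<open>Since \<open>h j\<close> is nonnegative, its integral over any box is at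
        most \<open>c j\<close>. Hence the single index \<open>k\<close> chosen above works for all
        large boxes at once.\<close>
      have hc: "0 \<le> integral (cbox a b) (h j)" "integral (cbox a b) (h j) \<le> c j" for j
        using has_integral_nonneg[OF hi] h0 has_integral_subset_le[OF _ hi h[of j]] by auto
      have c': "(\<lambda>j. integral (cbox a b) (h j)) \<longlonglongrightarrow> 0"
        by (rule real_tendsto_sandwich[OF _ _ tendsto_const c]) (use hc in auto)
      obtain z where z: "(\<lambda>j. integral (cbox a b) (Fk j)) \<longlonglongrightarrow> z"
        "\<And>j. norm (z - integral (cbox a b) (Fk j)) \<le> integral (cbox a b) (h j)"
        by (rule has_integral_L1_limit_aux[OF Fi hi le c']) (rule that)
      have "(F has_integral z) (cbox a b)"
        by (rule has_integral_L1_limit_cbox[OF Fi hi le c' z(1)])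
      moreover have "norm (z - L) < e"
      proof -
        have "norm (integral (cbox a b) (Fk k) - I k) < e / 3"
          using B(2)[OF ab] by (metis integral_unique)
        moreover have "norm (z - L) \<le> norm (z - integral (cbox a b) (Fk k))
            + norm (integral (cbox a b) (Fk k) - I k) + norm (L - I k)"
          using norm_triangle_ineq[of "z - integral (cbox a b) (Fk k)" "integral (cbox a b) (Fk k) - L"]
            norm_triangle_ineq[of "integral (cbox a b) (Fk k) - I k" "I k - L"]
          by (simp add: norm_minus_commute)
        ultimately show ?thesis
          using z(2)[of k] hc(2)[of k] L(2)[of k] k by linarith
      qed
      ultimately show ?thesis by blast
    qed
    with B(1) show "\<exists>B>0. \<forall>a b. ball 0 B \<subseteq> cbox a b \<longrightarrow>
       (\<exists>z. ((\<lambda>x. if x \<in> UNIV then F x else 0) has_integral z) (cbox a b) \<and> norm (z - L) < e)"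
      by auto
  qed
  with L(1) that show thesis by blast
qed

section \<open>Integrals of bounded continuous functions against nonnegative kernels\<close>

text \<open>Finite mass is stated with the nonnegative integral because Tonelli is applied to it;
  \<open>kernel_has_integral\<close> translates it into the gauge integral.\<close>

definition kernel :: "(real \<Rightarrow> real) \<Rightarrow> bool" where
  "kernel f \<longleftrightarrow> f \<in> borel_measurable borel \<and> (\<forall>u. 0 \<le> f u) \<and> (\<integral>\<^sup>+u. f u \<partial>lborel) < \<infinity>"

lemma
  assumes "kernel f"
  shows kernel_measurable: "f \<in> borel_measurable borel" and kernel_nonneg: "0 \<le> f u"
    and kernel_finite: "(\<integral>\<^sup>+u. f u \<partial>lborel) < \<infinity>"
  using assms by (auto simp: kernel_def)

text \<open>The scalar functions that get averaged: indicators of grid cells and norms of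
  approximation errors.\<close>

definition bdd_borel :: "(real \<Rightarrow> real) \<Rightarrow> bool" where
  "bdd_borel \<phi> \<longleftrightarrow> \<phi> \<in> borel_measurable borel \<and> (\<forall>u. 0 \<le> \<phi> u) \<and> (\<exists>B. \<forall>u. \<phi> u \<le> B)"

lemma
  assumes "bdd_borel \<phi>"
  shows bdd_borel_measurable: "\<phi> \<in> borel_measurable borel" and bdd_borel_nonneg: "0 \<le> \<phi> u"
  using assms by (auto simp: bdd_borel_def)

definition avg :: "(real \<Rightarrow> real) \<Rightarrow> (real \<Rightarrow> real) \<Rightarrow> real" where
  "avg f \<phi> = integral UNIV (\<lambda>u. f u * \<phi> u)"

lemma kernel_mult:
  assumes f: "kernel f" and \<phi>: "bdd_borel \<phi>"
  shows "kernel (\<lambda>u. f u * \<phi> u)"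
proof -
  obtain B where B: "\<And>u. \<phi> u \<le> B" using \<phi> by (auto simp: bdd_borel_def)
  have B0: "0 \<le> B" using B[of 0] bdd_borel_nonneg[OF \<phi>, of 0] by linarith
  note [measurable] = kernel_measurable[OF f] bdd_borel_measurable[OF \<phi>]
  have "(\<integral>\<^sup>+u. f u * \<phi> u \<partial>lborel) \<le> (\<integral>\<^sup>+u. ennreal B * f u \<partial>lborel)"
    using B kernel_nonneg[OF f] B0
    by (intro nn_integral_mono) (auto simp: ennreal_mult'[symmetric] mult.commute[of B] intro!: ennreal_leI mult_left_mono)
  also have "\<dots> = ennreal B * (\<integral>\<^sup>+u. f u \<partial>lborel)"
    by (rule nn_integral_cmult) simp
  also have "\<dots> < \<infinity>"
    using kernel_finite[OF f] by (simp add: ennreal_mult_less_top)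
  finally show ?thesis
    using kernel_nonneg[OF f] bdd_borel_nonneg[OF \<phi>] by (auto simp: kernel_def)
qed

lemma kernel_has_integral:
  assumes f: "kernel f"
  shows "(f has_integral integral UNIV f) UNIV" "(\<integral>\<^sup>+u. f u \<partial>lborel) = ennreal (integral UNIV f)"
    "0 \<le> integral UNIV f"
proof -
  have "f integrable_on UNIV"
    using f by (intro nn_integral_integrable_on) (auto simp: kernel_def)
  then show 1: "(f has_integral integral UNIV f) UNIV" by (rule integrable_integral)
  then show "(\<integral>\<^sup>+u. f u \<partial>lborel) = ennreal (integral UNIV f)"
    using f by (intro nn_integral_has_integral_lborel) (auto simp: kernel_def)
  show "0 \<le> integral UNIV f"
    using 1 f by (auto intro: has_integral_nonneg simp: kernel_def)
qed

lemma avg: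
  assumes "kernel f" and "bdd_borel \<phi>"
  shows avg_has_integral: "((\<lambda>u. f u * \<phi> u) has_integral avg f \<phi>) UNIV"
    and nn_integral_avg: "(\<integral>\<^sup>+u. ennreal (f u * \<phi> u) \<partial>lborel) = ennreal (avg f \<phi>)"
    and avg_nonneg: "0 \<le> avg f \<phi>"
  using kernel_has_integral[OF kernel_mult[OF assms]] by (auto simp: avg_def)

text \<open>Lebesgue's dominated convergence with majorant \<open>f u * B\<close>. It supplies the
  hypothesis \<open>c \<longlonglongrightarrow> 0\<close> of
  \<open>has_integral_L1_limit\<close>.\<close>

lemma avg_tendsto_0:
  assumes f: "kernel f" and \<phi>: "\<And>k::nat. bdd_borel (\<phi> k)" and B: "\<And>k u. \<phi> k u \<le> B"
    and lim: "\<And>u. (\<lambda>k. \<phi> k u) \<longlonglongrightarrow> 0"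
  shows "(\<lambda>k. avg f (\<phi> k)) \<longlonglongrightarrow> 0"
proof -
  note [measurable] = kernel_measurable[OF f] bdd_borel_measurable[OF \<phi>]
  have fi: "integrable lborel f"
    using f by (intro integrableI_bounded) (auto simp: kernel_def)
  have "(\<lambda>k. \<integral>u. f u * \<phi> k u \<partial>lborel) \<longlonglongrightarrow> (\<integral>u. f u * 0 \<partial>lborel)"
  proof (rule integral_dominated_convergence[where w = "\<lambda>u. f u * B"])
    show "integrable lborel (\<lambda>u. f u * B)" using fi by simp
    show "AE u in lborel. (\<lambda>k. f u * \<phi> k u) \<longlonglongrightarrow> f u * 0"
      by (intro AE_I2 tendsto_intros lim)
    show "AE u in lborel. norm (f u * \<phi> k u) \<le> f u * B" for k
      using kernel_nonneg[OF f] bdd_borel_nonneg[OF \<phi>] B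
      by (intro AE_I2) (auto simp: abs_mult intro!: mult_left_mono)
  qed auto
  moreover have "(\<integral>u. f u * \<phi> k u \<partial>lborel) = avg f (\<phi> k)" for k
  proof -
    have "integrable lborel (\<lambda>u. f u * \<phi> k u)"
      using kernel_mult[OF f \<phi>[of k]] by (intro integrableI_bounded) (auto simp: kernel_def)
    then have "((\<lambda>u. f u * \<phi> k u) has_integral (\<integral>u. f u * \<phi> k u \<partial>lborel)) UNIV"
      by (rule has_integral_integral_lborel)
    then show ?thesis by (rule has_integral_unique[OF _ avg_has_integral[OF f \<phi>]])
  qed
  ultimately show ?thesis by simp
qed

text \<open>A relation rather than an operation: in each use the convolution has a closed form
  \<open>h\<close>, and it is matched at every point, not just almost everywhere.\<close>

definition convolves :: "(real \<Rightarrow> real) \<Rightarrow> (real \<Rightarrow> real) \<Rightarrow> (real \<Rightarrow> real) \<Rightarrow> bool" where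
  "convolves f g h \<longleftrightarrow> kernel f \<and> kernel g \<and> kernel h \<and>
     (\<forall>u. (\<integral>\<^sup>+s. ennreal (f s * g (u - s)) \<partial>lborel) = ennreal (h u))"

lemma bdd_borel_shift:
  assumes "bdd_borel \<phi>"
  shows "bdd_borel (\<lambda>t. \<phi> (s + t))"
proof -
  note [measurable] = bdd_borel_measurable[OF assms]
  have "(\<lambda>t. \<phi> (s + t)) \<in> borel_measurable borel" by measurable
  with assms show ?thesis by (auto simp: bdd_borel_def)
qed

text \<open>Tonelli after the substitution t = u - s in the inner integral.\<close>

lemma avg_convolution:
  assumes c: "convolves f g h" and \<phi>: "bdd_borel \<phi>"
  shows "((\<lambda>s. f s * avg g (\<lambda>t. \<phi> (s + t))) has_integral avg h \<phi>) UNIV"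
proof -
  have f: "kernel f" and g: "kernel g" and h: "kernel h"
    and conv: "\<And>u. (\<integral>\<^sup>+s. ennreal (f s * g (u - s)) \<partial>lborel) = ennreal (h u)"
    using c by (auto simp: convolves_def)
  note [measurable] = kernel_measurable[OF f] kernel_measurable[OF g] kernel_measurable[OF h]
    bdd_borel_measurable[OF \<phi>]
  note [simp] = kernel_nonneg[OF f] kernel_nonneg[OF g] kernel_nonneg[OF h] bdd_borel_nonneg[OF \<phi>]
  define \<psi> where "\<psi> s = avg g (\<lambda>t. \<phi> (s + t))" for s
  have \<psi>: "ennreal (\<psi> s) = (\<integral>\<^sup>+t. ennreal (g t * \<phi> (s + t)) \<partial>lborel)" for s
    unfolding \<psi>_def using nn_integral_avg[OF g bdd_borel_shift[OF \<phi>]] by simp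
  have \<psi>0: "0 \<le> \<psi> s" for s
    unfolding \<psi>_def by (rule avg_nonneg[OF g bdd_borel_shift[OF \<phi>]])
  \<comment> \<open>Measurability of the inner average is read off from its form as a nonnegative
    parameter integral.\<close>
  have "(\<lambda>s. enn2real (\<integral>\<^sup>+t. ennreal (g t * \<phi> (s + t)) \<partial>lborel)) \<in> borel_measurable borel"
    by measurable
  then have \<psi>m [measurable]: "\<psi> \<in> borel_measurable borel"
    unfolding \<psi>[symmetric] using \<psi>0 by simp
  have shift: "(\<integral>\<^sup>+t. ennreal (g t * \<phi> (s + t)) \<partial>lborel) = (\<integral>\<^sup>+u. ennreal (g (u - s) * \<phi> u) \<partial>lborel)" for s
  proof -
    have "(\<integral>\<^sup>+u. ennreal (g (u - s) * \<phi> u) \<partial>lborel)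
        = (\<integral>\<^sup>+u. ennreal (g (u - s) * \<phi> u) \<partial>distr lborel borel ((+) s))"
      by (simp add: lborel_distr_plus)
    also have "\<dots> = (\<integral>\<^sup>+t. ennreal (g t * \<phi> (s + t)) \<partial>lborel)"
      by (subst nn_integral_distr) (auto simp: add.commute)
    finally show ?thesis by simp
  qed
  have "ennreal (f s * \<psi> s) = (\<integral>\<^sup>+u. ennreal (f s) * ennreal (g (u - s) * \<phi> u) \<partial>lborel)" for s
  proof -
    have "ennreal (f s * \<psi> s) = ennreal (f s) * ennreal (\<psi> s)"
      by (simp add: ennreal_mult')
    also have "\<dots> = (\<integral>\<^sup>+u. ennreal (f s) * ennreal (g (u - s) * \<phi> u) \<partial>lborel)"
      unfolding \<psi> shift by (rule nn_integral_cmult[symmetric]) measurable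
    finally show ?thesis .
  qed
  then have "(\<integral>\<^sup>+s. ennreal (f s * \<psi> s) \<partial>lborel)
      = (\<integral>\<^sup>+s. (\<integral>\<^sup>+u. ennreal (f s) * ennreal (g (u - s) * \<phi> u) \<partial>lborel) \<partial>lborel)"
    by simp
  also have "\<dots> = (\<integral>\<^sup>+u. (\<integral>\<^sup>+s. ennreal (f s) * ennreal (g (u - s) * \<phi> u) \<partial>lborel) \<partial>lborel)"
    by (rule lborel_pair.Fubini') measurable
  also have "\<dots> = (\<integral>\<^sup>+u. (\<integral>\<^sup>+s. ennreal (\<phi> u) * ennreal (f s * g (u - s)) \<partial>lborel) \<partial>lborel)"
    by (intro nn_integral_cong) (simp add: ennreal_mult'[symmetric] mult_ac)
  also have "\<dots> = (\<integral>\<^sup>+u. ennreal (h u * \<phi> u) \<partial>lborel)"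
  proof (rule nn_integral_cong)
    fix u
    have "(\<integral>\<^sup>+s. ennreal (\<phi> u) * ennreal (f s * g (u - s)) \<partial>lborel) = ennreal (\<phi> u) * ennreal (h u)"
      unfolding conv[symmetric] by (rule nn_integral_cmult) measurable
    then show "(\<integral>\<^sup>+s. ennreal (\<phi> u) * ennreal (f s * g (u - s)) \<partial>lborel) = ennreal (h u * \<phi> u)"
      by (simp add: ennreal_mult mult.commute)
  qed
  also have "\<dots> = ennreal (avg h \<phi>)"
    by (rule nn_integral_avg[OF h \<phi>])
  finally have "((\<lambda>s. f s * \<psi> s) has_integral avg h \<phi>) UNIV"
    by (intro nn_integral_has_integral) (auto simp: \<psi>0 avg_nonneg[OF h \<phi>])
  then show ?thesis by (simp add: \<psi>_def)
qed

section \<open>Step approximation of vector-valued functions on a grid of mesh 1/k\<close>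

definition cell :: "nat \<Rightarrow> int \<Rightarrow> real set" where
  "cell k j = {u. \<bar>u\<bar> < real k \<and> \<lfloor>real k * u\<rfloor> = j}"

text \<open>\<open>F\<close> is sampled at the left end of the cell containing \<open>u\<close> and
  cut off outside a bounded interval, so only finitely many values occur and the integral against a
  kernel is a finite sum. The cell indices lie between \<open>- (k * k)\<close> and
  \<open>k * k\<close>.\<close>

definition step_approx :: "nat \<Rightarrow> (real \<Rightarrow> 'a::real_normed_vector) \<Rightarrow> real \<Rightarrow> 'a" where
  "step_approx k F u = (if \<bar>u\<bar> < real k then F (of_int \<lfloor>real k * u\<rfloor> / real k) else 0)"

lemma bdd_borel_indicator_cell: "bdd_borel (indicator (cell k j))"
  unfolding bdd_borel_def cell_def
  by (intro conjI exI[of _ 1] allI) (auto simp: indicator_def)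

lemma step_approx_eq_sum:
  "step_approx k F u = (\<Sum>j\<in>{-int (k * k)..int (k * k)}. indicator (cell k j) u *\<^sub>R F (of_int j / real k))"
proof (cases "\<bar>u\<bar> < real k")
  case True
  have "real k * \<bar>u\<bar> \<le> real k * real k"
    using True by (intro mult_left_mono) auto
  then have "\<bar>real k * u\<bar> \<le> real (k * k)" by (simp add: abs_mult)
  then have *: "\<lfloor>real k * u\<rfloor> \<in> {-int (k * k)..int (k * k)}"
    by (simp add: floor_le_iff le_floor_iff) linarith
  have "(\<Sum>j\<in>{-int (k * k)..int (k * k)}. indicator (cell k j) u *\<^sub>R F (of_int j / real k))
      = (\<Sum>j\<in>{-int (k * k)..int (k * k)}. if \<lfloor>real k * u\<rfloor> = j then F (of_int j / real k) else 0)"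
    using True by (intro sum.cong) (auto simp: cell_def)
  also have "\<dots> = F (of_int \<lfloor>real k * u\<rfloor> / real k)"
    using * by (subst sum.delta'[OF finite_atLeastAtMost_int]) auto
  finally show ?thesis using True by (simp add: step_approx_def)
qed (simp add: step_approx_def cell_def)

lemma step_approx_LIMSEQ:
  assumes "continuous_on UNIV F"
  shows "(\<lambda>k. step_approx k F u) \<longlonglongrightarrow> F u"
proof -
  have "(\<lambda>k. of_int \<lfloor>real k * u\<rfloor> / real k) \<longlonglongrightarrow> u"
  proof (rule LIM_zero_cancel, rule Lim_null_comparison)
    show "(\<lambda>k. inverse (real k)) \<longlonglongrightarrow> 0"
      by (rule lim_inverse_n)
    have "norm (of_int \<lfloor>real k * u\<rfloor> / real k - u) \<le> inverse (real k)" if "k \<ge> 1" for k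
    proof -
      have "\<bar>of_int \<lfloor>real k * u\<rfloor> - real k * u\<bar> \<le> 1" by linarith
      moreover have "of_int \<lfloor>real k * u\<rfloor> / real k - u = (of_int \<lfloor>real k * u\<rfloor> - real k * u) / real k"
        using that by (simp add: field_simps)
      ultimately show ?thesis
        using that by (simp add: inverse_eq_divide divide_right_mono)
    qed
    then show "eventually (\<lambda>k. norm (of_int \<lfloor>real k * u\<rfloor> / real k - u) \<le> inverse (real k)) sequentially"
      by (auto simp: eventually_sequentially)
  qed
  then have "(\<lambda>k. F (of_int \<lfloor>real k * u\<rfloor> / real k)) \<longlonglongrightarrow> F u"
    using assms by (intro continuous_on_tendsto_compose[OF assms]) auto
  moreover have "eventually (\<lambda>k. F (of_int \<lfloor>real k * u\<rfloor> / real k) = step_approx k F u) sequentially"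
  proof -
    have "eventually (\<lambda>k. \<bar>u\<bar> < real k) sequentially"
      using filterlim_real_sequentially by (simp add: filterlim_at_top_dense)
    then show ?thesis by eventually_elim (simp add: step_approx_def)
  qed
  ultimately show ?thesis by (rule Lim_transform_eventually)
qed

definition bdd_cont :: "real \<Rightarrow> (real \<Rightarrow> 'a::real_normed_vector) \<Rightarrow> bool" where
  "bdd_cont M F \<longleftrightarrow> continuous_on UNIV F \<and> (\<forall>u. norm (F u) \<le> M)"

definition defect :: "nat \<Rightarrow> (real \<Rightarrow> 'a::real_normed_vector) \<Rightarrow> real \<Rightarrow> real" where
  "defect k F u = norm (F u - step_approx k F u)"

lemma defect_le:
  assumes "bdd_cont M F"
  shows "defect k F u \<le> 2 * M"
proof -
  have M: "norm (F v) \<le> M" for v using assms by (simp add: bdd_cont_def)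
  then have "norm (step_approx k F u) \<le> M"
    using order.trans[OF norm_ge_zero M] by (simp add: step_approx_def)
  then show ?thesis
    unfolding defect_def using M[of u] norm_triangle_ineq4[of "F u" "step_approx k F u"] by linarith
qed

text \<open>The norm of \<open>F u - F v\<close> is a continuous real function of the pair (u, v),
  and the pair of \<open>u\<close> and its grid point depends measurably on \<open>u\<close>. This
  avoids measurability of vector-valued functions altogether.\<close>

lemma bdd_borel_defect:
  assumes F: "bdd_cont M F"
  shows "bdd_borel (defect k F)"
proof -
  have cF: "continuous_on UNIV F" using F by (simp add: bdd_cont_def)
  have "continuous_on UNIV (\<lambda>z::real \<times> real. norm (F (fst z) - F (snd z)))"
    by (intro continuous_intros continuous_on_compose2[OF cF]) auto
  then have m [measurable]: "(\<lambda>z::real \<times> real. norm (F (fst z) - F (snd z))) \<in> borel_measurable borel"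
    by (rule borel_measurable_continuous_onI)
  have "continuous_on UNIV (\<lambda>u. norm (F u))"
    by (intro continuous_intros cF)
  then have [measurable]: "(\<lambda>u. norm (F u)) \<in> borel_measurable borel"
    by (rule borel_measurable_continuous_onI)
  have "(\<lambda>u. (u, of_int \<lfloor>real k * u\<rfloor> / real k)) \<in> borel \<rightarrow>\<^sub>M (borel :: (real \<times> real) measure)"
    by (simp add: borel_prod[symmetric])
  from measurable_compose[OF this m]
  have [measurable]: "(\<lambda>u. norm (F u - F (of_int \<lfloor>real k * u\<rfloor> / real k))) \<in> borel_measurable borel"
    by simp
  have "defect k F = (\<lambda>u. if \<bar>u\<bar> < real k then norm (F u - F (of_int \<lfloor>real k * u\<rfloor> / real k)) else norm (F u))"
    by (auto simp: defect_def step_approx_def)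
  also have "\<dots> \<in> borel_measurable borel" by measurable
  finally show ?thesis
    using defect_le[OF F] by (auto simp: bdd_borel_def defect_def)
qed

lemma avg_defect_tendsto_0:
  assumes f: "kernel f" and F: "bdd_cont M F"
  shows "(\<lambda>k. avg f (defect k F)) \<longlonglongrightarrow> 0"
proof (rule avg_tendsto_0[OF f bdd_borel_defect[OF F] defect_le[OF F]])
  fix u
  have "(\<lambda>k. norm (F u - step_approx k F u)) \<longlonglongrightarrow> norm (F u - F u)"
    using F by (intro tendsto_intros step_approx_LIMSEQ) (simp add: bdd_cont_def)
  then show "(\<lambda>k. defect k F u) \<longlonglongrightarrow> 0"
    by (simp add: defect_def)
qed

text \<open>The shift \<open>s\<close> moves the argument but not the grid, so the same finitely
  many vectors appear for every \<open>s\<close> and an outer integration over \<open>s\<close> acts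
  on scalar coefficients only.\<close>

definition step_integral :: "(real \<Rightarrow> real) \<Rightarrow> nat \<Rightarrow> real \<Rightarrow> (real \<Rightarrow> 'a::real_normed_vector) \<Rightarrow> 'a" where
  "step_integral f k s F =
     (\<Sum>j\<in>{-int (k * k)..int (k * k)}. avg f (\<lambda>t. indicator (cell k j) (s + t)) *\<^sub>R F (of_int j / real k))"

lemma has_integral_step_integral:
  assumes f: "kernel f"
  shows "((\<lambda>t. f t *\<^sub>R step_approx k F (s + t)) has_integral step_integral f k s F) UNIV"
proof -
  have "((\<lambda>t. \<Sum>j\<in>{-int (k * k)..int (k * k)}. (f t * indicator (cell k j) (s + t)) *\<^sub>R F (of_int j / real k))
      has_integral step_integral f k s F) UNIV"
    unfolding step_integral_def
    by (intro has_integral_sum finite_atLeastAtMost_int has_integral_scaleR_left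
        avg_has_integral[OF f bdd_borel_shift[OF bdd_borel_indicator_cell]])
  then show ?thesis
    unfolding step_approx_eq_sum scaleR_sum_right scaleR_scaleR .
qed

definition gint :: "(real \<Rightarrow> real) \<Rightarrow> (real \<Rightarrow> 'a::real_normed_vector) \<Rightarrow> 'a" where
  "gint f F = integral UNIV (\<lambda>u. f u *\<^sub>R F u)"

lemma
  fixes F :: "real \<Rightarrow> 'a::banach"
  assumes f: "kernel f" and F: "bdd_cont M F"
  shows gint_has_integral: "((\<lambda>u. f u *\<^sub>R F u) has_integral gint f F) UNIV"
    and step_integral_LIMSEQ: "(\<lambda>k. step_integral f k 0 F) \<longlonglongrightarrow> gint f F"
proof -
  obtain L where L: "((\<lambda>u. f u *\<^sub>R F u) has_integral L) UNIV" "(\<lambda>k. step_integral f k 0 F) \<longlonglongrightarrow> L"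
  proof (rule has_integral_L1_limit)
    show "((\<lambda>u. f u *\<^sub>R step_approx k F u) has_integral step_integral f k 0 F) UNIV" for k
      using has_integral_step_integral[OF f, of k F 0] by simp
    show "((\<lambda>u. f u * defect k F u) has_integral avg f (defect k F)) UNIV" for k
      by (rule avg_has_integral[OF f bdd_borel_defect[OF F]])
    show "norm (f u *\<^sub>R F u - f u *\<^sub>R step_approx k F u) \<le> f u * defect k F u" for k u
      using kernel_nonneg[OF f, of u] by (simp add: defect_def flip: scaleR_diff_right)
    show "(\<lambda>k. avg f (defect k F)) \<longlonglongrightarrow> 0"
      by (rule avg_defect_tendsto_0[OF f F])
  qed
  moreover have "L = gint f F" using L(1) by (simp add: gint_def integral_unique)
  ultimately show "((\<lambda>u. f u *\<^sub>R F u) has_integral gint f F) UNIV"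
    "(\<lambda>k. step_integral f k 0 F) \<longlonglongrightarrow> gint f F" by auto
qed

lemma bdd_cont_shift:
  assumes "bdd_cont M F" shows "bdd_cont M (\<lambda>t. F (s + t))"
  using assms unfolding bdd_cont_def
  by (auto intro!: continuous_on_compose2[of UNIV F] continuous_intros)

text \<open>Fubini for vector-valued \<open>F\<close>. For the step approximations it is
  \<open>avg_convolution\<close> cell by cell. The inner errors are bounded by averaged defects, and
  \<open>avg_convolution\<close> turns their outer average into the average of the defect against
  \<open>h\<close>, which tends to zero.\<close>

lemma gint_convolution:
  fixes F :: "real \<Rightarrow> 'a::banach"
  assumes c: "convolves f g h" and F: "bdd_cont M F"
  shows "gint f (\<lambda>s. gint g (\<lambda>t. F (s + t))) = gint h F"
proof -
  have f: "kernel f" and g: "kernel g" and h: "kernel h"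
    using c by (auto simp: convolves_def)
  obtain L where L: "((\<lambda>s. f s *\<^sub>R gint g (\<lambda>t. F (s + t))) has_integral L) UNIV"
    "(\<lambda>k. step_integral h k 0 F) \<longlonglongrightarrow> L"
  proof (rule has_integral_L1_limit)
    show "((\<lambda>s. f s *\<^sub>R step_integral g k s F) has_integral step_integral h k 0 F) UNIV" for k
    proof -
      have "((\<lambda>s. \<Sum>j\<in>{-int (k * k)..int (k * k)}.
           (f s * avg g (\<lambda>t. indicator (cell k j) (s + t))) *\<^sub>R F (of_int j / real k))
         has_integral step_integral h k 0 F) UNIV"
        unfolding step_integral_def add_0_left
        by (intro has_integral_sum finite_atLeastAtMost_int has_integral_scaleR_left
            avg_convolution[OF c bdd_borel_indicator_cell])
      then show ?thesis by (simp add: step_integral_def scaleR_sum_right)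
    qed
    show "((\<lambda>s. f s * avg g (\<lambda>t. defect k F (s + t))) has_integral avg h (defect k F)) UNIV" for k
      by (rule avg_convolution[OF c bdd_borel_defect[OF F]])
    show "norm (f s *\<^sub>R gint g (\<lambda>t. F (s + t)) - f s *\<^sub>R step_integral g k s F)
        \<le> f s * avg g (\<lambda>t. defect k F (s + t))" for k s
    proof -
      have "norm (gint g (\<lambda>t. F (s + t)) - step_integral g k s F) \<le> avg g (\<lambda>t. defect k F (s + t))"
      proof -
        have a: "((\<lambda>t. g t *\<^sub>R F (s + t) - g t *\<^sub>R step_approx k F (s + t)) has_integral
              gint g (\<lambda>t. F (s + t)) - step_integral g k s F) UNIV"
          by (intro has_integral_diff gint_has_integral[OF g bdd_cont_shift[OF F]]
              has_integral_step_integral[OF g])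
        have b: "((\<lambda>t. g t * defect k F (s + t)) has_integral avg g (\<lambda>t. defect k F (s + t))) UNIV"
          by (rule avg_has_integral[OF g bdd_borel_shift[OF bdd_borel_defect[OF F]]])
        have d: "norm (g t *\<^sub>R F (s + t) - g t *\<^sub>R step_approx k F (s + t)) \<le> g t * defect k F (s + t)" for t
          using kernel_nonneg[OF g, of t] by (simp add: defect_def flip: scaleR_diff_right)
        show ?thesis
          using integral_norm_bound_integral[OF has_integral_integrable[OF a] has_integral_integrable[OF b] d]
          by (simp add: integral_unique[OF a] integral_unique[OF b])
      qed
      then show ?thesis
        using kernel_nonneg[OF f, of s] by (simp add: mult_left_mono flip: scaleR_diff_right)
    qed
    show "(\<lambda>k. avg h (defect k F)) \<longlonglongrightarrow> 0"
      by (rule avg_defect_tendsto_0[OF h F])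
  qed
  have "L = gint h F"
    by (rule LIMSEQ_unique[OF L(2) step_integral_LIMSEQ[OF h F]])
  with L(1) show ?thesis
    by (simp add: gint_def[of f] integral_unique)
qed

section \<open>The Gamma densities\<close>

text \<open>The weight in (I - A)^(-a), normalised to mass one and extended by zero, so that the law
  for the powers becomes a convolution identity on the whole line.\<close>

definition gamma_density :: "real \<Rightarrow> real \<Rightarrow> real" where
  "gamma_density a u = (if 0 < u then u powr (a - 1) * exp (- u) / Gamma a else 0)"

lemma gamma_density_nonneg: "0 < a \<Longrightarrow> 0 \<le> gamma_density a u"
  by (simp add: gamma_density_def Gamma_real_pos less_imp_le)

lemma gamma_density_measurable [measurable]: "gamma_density a \<in> borel_measurable borel"
  unfolding gamma_density_def by measurable

lemma gamma_density_has_integral: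
  assumes a: "0 < a"
  shows "(gamma_density a has_integral 1) UNIV"
proof -
  have "((\<lambda>t. (t powr (a - 1) / exp t) / Gamma a) has_integral Gamma a / Gamma a) {0..}"
    by (intro has_integral_divide Gamma_integral_real a)
  moreover have "Gamma a \<noteq> 0" using Gamma_real_pos[OF a] by simp
  ultimately have "((\<lambda>t. (t powr (a - 1) / exp t) / Gamma a) has_integral 1) {0..}"
    by simp
  then have "((\<lambda>t. gamma_density a t) has_integral 1) {0..}"
    by (rule has_integral_spike[OF negligible_sing[of 0], rotated])
      (auto simp: gamma_density_def exp_minus divide_simps)
  then show ?thesis
    by (rule has_integral_on_superset) (auto simp: gamma_density_def)
qed

lemma kernel_gamma_density:
  assumes "0 < a"
  shows "kernel (gamma_density a)"
  using nn_integral_has_integral_lborel[OF gamma_density_measurable gamma_density_nonneg[OF assms]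
      gamma_density_has_integral[OF assms]] gamma_density_nonneg[OF assms]
  by (simp add: kernel_def)

text \<open>For u > 0 the substitution s = u x yields a Beta integral, and Beta(a, b) = \<Gamma>(a)
  \<Gamma>(b) / \<Gamma>(a + b) adjusts the normalisation.\<close>

lemma gamma_density_convolution:
  assumes a: "0 < a" and b: "0 < b"
  shows "convolves (gamma_density a) (gamma_density b) (gamma_density (a + b))"
proof -
  have "(\<integral>\<^sup>+s. ennreal (gamma_density a s * gamma_density b (u - s)) \<partial>lborel) = ennreal (gamma_density (a + b) u)" for u
  proof (cases "0 < u")
    case False
    then have z: "gamma_density a s * gamma_density b (u - s) = 0" for s
      by (auto simp: gamma_density_def)
    have "gamma_density (a + b) u = 0"
      using False by (simp add: gamma_density_def)
    then show ?thesis unfolding z by simp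
  next
    case u: True
    \<comment> \<open>\<open>B\<close> is set to zero outside the open unit interval, exactly where
      the product of the two densities vanishes after s = u x; \<open>C\<close> collects the factors
      that do not depend on x, apart from the Jacobian u.\<close>
    define B where "B x = (if 0 < x \<and> x < 1 then x powr (a - 1) * (1 - x) powr (b - 1) else 0)" for x :: real
    define C where "C = u powr (a + b - 2) * exp (- u) / (Gamma a * Gamma b)"
    have C0: "0 \<le> C" using a b by (simp add: C_def Gamma_real_pos less_imp_le)
    have [measurable]: "B \<in> borel_measurable borel" unfolding B_def by measurable
    have B0: "0 \<le> B x" for x by (simp add: B_def)
    have "(B has_integral Beta a b) {0..1}"
      by (rule has_integral_spike[OF _ _ has_integral_Beta_real[OF a b], of "{0, 1}"])
        (auto simp: B_def)
    then have "(B has_integral Beta a b) UNIV"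
      by (rule has_integral_on_superset) (auto simp: B_def)
    then have B: "(\<integral>\<^sup>+x. ennreal (B x) \<partial>lborel) = ennreal (Beta a b)"
      by (intro nn_integral_has_integral_lborel) (auto simp: B0)
    have eq: "gamma_density a (u * x) * gamma_density b (u - u * x) = C * B x" for x
    proof (cases "0 < x \<and> x < 1")
      case True
      have e: "exp (- (u * x)) * exp (- (u * (1 - x))) = exp (- u)"
        by (simp add: exp_add[symmetric] algebra_simps)
      have p: "u powr (a - 1) * u powr (b - 1) = u powr (a + b - 2)"
        by (simp add: powr_add[symmetric])
      have "0 < u - u * x" "u - u * x = u * (1 - x)"
        using True u by (auto simp: algebra_simps)
      then have "gamma_density a (u * x) * gamma_density b (u - u * x)
          = (u powr (a - 1) * u powr (b - 1)) * (exp (- (u * x)) * exp (- (u * (1 - x))))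
            * (x powr (a - 1) * (1 - x) powr (b - 1)) / (Gamma a * Gamma b)"
        using True u by (simp add: gamma_density_def powr_mult mult_ac)
      then show ?thesis
        unfolding e p using True by (simp add: B_def C_def)
    next
      case False
      then show ?thesis
        using u by (auto simp: gamma_density_def B_def zero_less_mult_iff)
    qed
    have "(\<integral>\<^sup>+s. ennreal (gamma_density a s * gamma_density b (u - s)) \<partial>lborel)
        = ennreal \<bar>u\<bar> * (\<integral>\<^sup>+x. ennreal (gamma_density a (0 + u * x) * gamma_density b (u - (0 + u * x))) \<partial>lborel)"
      using u by (intro nn_integral_real_affine) auto
    also have "\<dots> = ennreal u * (\<integral>\<^sup>+x. ennreal C * ennreal (B x) \<partial>lborel)"
      using u C0 by (simp add: eq ennreal_mult B0)
    also have "\<dots> = ennreal u * (ennreal C * ennreal (Beta a b))"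
      by (subst nn_integral_cmult) (auto simp: B)
    also have "\<dots> = ennreal (u * C * Beta a b)"
    proof -
      have "0 \<le> Beta a b"
        using a b by (simp add: Beta_def Gamma_real_pos less_imp_le)
      then show ?thesis
        using u C0 by (simp add: ennreal_mult mult.assoc)
    qed
    also have "u * C * Beta a b = gamma_density (a + b) u"
    proof -
      have "u * u powr (a + b - 2) = u powr (a + b - 1)"
        using u powr_add[of u 1 "a + b - 2"] by simp
      moreover have "Gamma a > 0" "Gamma b > 0" using a b by (auto intro: Gamma_real_pos)
      ultimately show ?thesis
        using u by (simp add: C_def gamma_density_def Beta_def)
    qed
    finally show ?thesis .
  qed
  then show ?thesis
    using a b by (simp add: convolves_def kernel_gamma_density)
qed

section \<open>Calculus for kernel integrals\<close>

lemma has_integral_shift_UNIV: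
  fixes f :: "real \<Rightarrow> 'a::banach"
  assumes "(f has_integral I) UNIV"
  shows "((\<lambda>x. f (x + c)) has_integral I) UNIV"
proof (subst has_integral', intro allI impI)
  fix e :: real assume "e > 0"
  then obtain B where B: "B > 0" "\<And>a b. ball 0 B \<subseteq> cbox a b \<Longrightarrow>
      \<exists>z. (f has_integral z) (cbox a b) \<and> norm (z - I) < e"
    using has_integral'[THEN iffD1, OF assms, rule_format, of e] by auto
  have "\<exists>z. ((\<lambda>x. f (x + c)) has_integral z) (cbox a b) \<and> norm (z - I) < e"
    if ab: "ball 0 (B + \<bar>c\<bar>) \<subseteq> cbox a b" for a b
  proof -
    have "ball 0 B \<subseteq> cbox (a + c) (b + c)"
    proof
      fix x :: real assume "x \<in> ball 0 B"
      then have "x - c \<in> ball 0 (B + \<bar>c\<bar>)" by (auto simp: dist_norm)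
      with ab have "x - c \<in> cbox a b" by blast
      then show "x \<in> cbox (a + c) (b + c)" by auto
    qed
    then obtain z where z: "(f has_integral z) (cbox (a + c) (b + c))" "norm (z - I) < e"
      using B by blast
    then show ?thesis
      using has_integral_affinity'[OF z(1), of 1 c] by auto
  qed
  then show "\<exists>B>0. \<forall>a b. ball 0 B \<subseteq> cbox a b \<longrightarrow>
      (\<exists>z. ((\<lambda>x. if x \<in> UNIV then f (x + c) else 0) has_integral z) (cbox a b) \<and> norm (z - I) < e)"
    using B(1) by (intro exI[of _ "B + \<bar>c\<bar>"]) auto
qed

lemma gint_cong:
  assumes "\<And>u. f u \<noteq> 0 \<Longrightarrow> F u = G u"
  shows "gint f F = gint f G"
proof -
  have "f u *\<^sub>R F u = f u *\<^sub>R G u" for u using assms[of u] by (cases "f u = 0") auto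
  then have "(\<lambda>u. f u *\<^sub>R F u) = (\<lambda>u. f u *\<^sub>R G u)" by (rule ext)
  then show ?thesis unfolding gint_def by (rule arg_cong)
qed

lemma kernel_cmult:
  assumes f: "kernel f" and c: "0 \<le> c"
  shows "kernel (\<lambda>u. c * f u)"
  using kernel_mult[OF f, of "\<lambda>_. c"] c by (auto simp: bdd_borel_def mult.commute)

lemma kernel_shift:
  assumes f: "kernel f" shows "kernel (\<lambda>u. f (u - s))"
proof -
  note [measurable] = kernel_measurable[OF f]
  have m: "(\<lambda>u. f (u - s)) \<in> borel_measurable borel" by measurable
  have "((\<lambda>u. f (u - s)) has_integral integral UNIV f) UNIV"
    using has_integral_shift_UNIV[OF kernel_has_integral(1)[OF f], of "- s"] by simp
  from nn_integral_has_integral_lborel[OF m _ this] m show ?thesis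
    using kernel_nonneg[OF f] by (simp add: kernel_def)
qed

context
  fixes f :: "real \<Rightarrow> real" and F :: "real \<Rightarrow> 'a::banach" and M :: real
  assumes f: "kernel f" and F: "bdd_cont M F"
begin

lemma gint_norm_le:
  assumes "\<And>u. f u \<noteq> 0 \<Longrightarrow> norm (F u) \<le> B"
  shows "norm (gint f F) \<le> B * integral UNIV f"
proof -
  have g: "((\<lambda>u. f u *\<^sub>R F u) has_integral gint f F) UNIV" by (rule gint_has_integral[OF f F])
  have h: "((\<lambda>u. B * f u) has_integral B * integral UNIV f) UNIV"
    by (intro has_integral_mult_right kernel_has_integral f)
  have "norm (f u *\<^sub>R F u) \<le> B * f u" for u
    using assms[of u] kernel_nonneg[OF f, of u]
    by (cases "f u = 0") (auto simp: mult.commute[of B] intro!: mult_left_mono)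
  then show ?thesis
    using integral_norm_bound_integral[OF has_integral_integrable[OF g] has_integral_integrable[OF h]]
    by (simp add: integral_unique[OF h] gint_def)
qed

lemma gint_linear:
  assumes "bounded_linear L"
  shows "gint f (\<lambda>u. L (F u)) = L (gint f F)"
  using has_integral_linear[OF gint_has_integral[OF f F] assms] linear_simps(5)[OF assms]
  by (simp add: o_def gint_def integral_unique)

lemma gint_cmult_kernel: "gint (\<lambda>u. c * f u) F = c *\<^sub>R gint f F"
  using has_integral_cmul[OF gint_has_integral[OF f F], of c]
  by (simp add: gint_def integral_unique)

lemma gint_add_kernel:
  assumes g: "kernel g"
  shows "gint (\<lambda>u. f u + g u) F = gint f F + gint g F"
  using has_integral_add[OF gint_has_integral[OF f F] gint_has_integral[OF g F]]
  by (simp add: gint_def scaleR_add_left integral_unique)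

lemma gint_shift: "gint f (\<lambda>t. F (s + t)) = gint (\<lambda>u. f (u - s)) F"
proof -
  have "((\<lambda>u. f u *\<^sub>R F (s + u)) has_integral gint f (\<lambda>t. F (s + t))) UNIV"
    by (rule gint_has_integral[OF f bdd_cont_shift[OF F]])
  from has_integral_shift_UNIV[OF this, of "- s"] show ?thesis
    by (simp add: gint_def integral_unique)
qed

lemma gint_add:
  assumes G: "bdd_cont N G"
  shows "gint f (\<lambda>u. F u + G u) = gint f F + gint f G"
  using has_integral_add[OF gint_has_integral[OF f F] gint_has_integral[OF f G]]
  by (simp add: gint_def scaleR_add_right integral_unique)

lemma gint_diff:
  assumes G: "bdd_cont N G"
  shows "gint f (\<lambda>u. F u - G u) = gint f F - gint f G"
  using has_integral_diff[OF gint_has_integral[OF f F] gint_has_integral[OF f G]]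
  by (simp add: gint_def scaleR_diff_right integral_unique)

end

lemma kernel_indicator_Ioc: "kernel (indicator {a<..b})"
  by (cases "a \<le> b") (simp_all add: kernel_def ennreal_indicator)

lemma integral_indicator_Ioc: "a \<le> b \<Longrightarrow> integral UNIV (indicator {a<..b} :: real \<Rightarrow> real) = b - a"
  using kernel_has_integral(2,3)[OF kernel_indicator_Ioc[of a b]]
  by (simp add: ennreal_indicator emeasure_lborel_Ioc)

text \<open>The fundamental theorem of calculus at 0 from the right; it produces the difference
  quotients of the generator in \<open>gen_J1\<close> and \<open>gen_V\<close>.\<close>

lemma gint_indicator_right_deriv:
  fixes F :: "real \<Rightarrow> 'a::banach"
  assumes F: "bdd_cont M F"
  shows "((\<lambda>h. gint (indicator {0<..h}) F /\<^sub>R h) \<longlongrightarrow> F 0) (at_right 0)"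
proof (rule tendstoI)
  fix e :: real assume e: "e > 0"
  have "isCont F 0" using F by (simp add: bdd_cont_def continuous_on_eq_continuous_at)
  then obtain d where d: "d > 0" "\<And>u. \<bar>u\<bar> < d \<Longrightarrow> norm (F u - F 0) < e / 2"
    unfolding continuous_at_eps_delta using e by (metis dist_norm half_gt_zero_iff real_norm_def diff_zero)
  have "dist (gint (indicator {0<..h}) F /\<^sub>R h) (F 0) < e" if h: "0 < h" "h < d" for h
  proof -
    have c: "bdd_cont (norm (F 0)) (\<lambda>_::real. F 0)" by (simp add: bdd_cont_def)
    have "bdd_cont (M + norm (F 0)) (\<lambda>u. F u - F 0)"
      using F unfolding bdd_cont_def
      by (auto intro!: continuous_intros order.trans[OF norm_triangle_ineq4] add_mono)
    then have 1: "norm (gint (indicator {0<..h}) (\<lambda>u. F u - F 0)) \<le> e / 2 * integral UNIV (indicator {0<..h} :: real \<Rightarrow> real)"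
      by (rule gint_norm_le[OF kernel_indicator_Ioc])
        (use h d(2) in \<open>auto simp: indicator_def split: if_splits intro!: less_imp_le\<close>)
    have "((\<lambda>u. indicator {0<..h} u *\<^sub>R F 0) has_integral h *\<^sub>R F 0) UNIV"
      using has_integral_scaleR_left[OF kernel_has_integral(1)[OF kernel_indicator_Ioc[of 0 h]], of "F 0"]
        h integral_indicator_Ioc[of 0 h] by simp
    then have 2: "gint (indicator {0<..h}) (\<lambda>_. F 0) = h *\<^sub>R F 0"
      unfolding gint_def by (rule integral_unique)
    have 3: "norm (gint (indicator {0<..h}) F - h *\<^sub>R F 0) \<le> e / 2 * h"
      using 1 h by (simp add: gint_diff[OF kernel_indicator_Ioc F c] 2 integral_indicator_Ioc)
    have "gint (indicator {0<..h}) F /\<^sub>R h - F 0 = (gint (indicator {0<..h}) F - h *\<^sub>R F 0) /\<^sub>R h"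
      using h by (simp add: scaleR_diff_right)
    then have "norm (gint (indicator {0<..h}) F /\<^sub>R h - F 0) \<le> e / 2"
      using 3 h by (simp add: divide_simps mult.commute)
    then show ?thesis using e by (simp add: dist_norm)
  qed
  then show "\<forall>\<^sub>F h in at_right 0. dist (gint (indicator {0<..h}) F /\<^sub>R h) (F 0) < e"
    using d(1) by (auto simp: eventually_at_right_field)
qed

section \<open>Operators defined by kernel integrals over a bounded semigroup\<close>

lemma bounded_bilinear_scaleC:
  "bounded_bilinear (\<lambda>c (x :: 'a::complex_banach). c *\<^sub>C x)"
proof (rule bounded_bilinear.intro)
  show "\<exists>K. \<forall>c (x::'a). norm (c *\<^sub>C x) \<le> norm c * norm x * K"
    by (rule exI[of _ 1]) (simp add: norm_scaleC)
  show "(r *\<^sub>R c) *\<^sub>C x = r *\<^sub>R c *\<^sub>C x" for r c and x :: 'a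
    by (simp add: scaleR_conv_of_real scaleR_scaleC[where 'a = 'a] scaleC_scaleC)
  show "c *\<^sub>C r *\<^sub>R x = r *\<^sub>R c *\<^sub>C x" for r c and x :: 'a
    by (simp add: scaleR_scaleC scaleC_scaleC mult.commute)
qed (auto simp: scaleC_add_left scaleC_add_right)

lemmas bounded_linear_scaleC_right = bounded_bilinear.bounded_linear_right[OF bounded_bilinear_scaleC]
lemmas continuous_on_scaleC = bounded_bilinear.continuous_on[OF bounded_bilinear_scaleC]
lemmas tendsto_scaleC = bounded_bilinear.tendsto[OF bounded_bilinear_scaleC]
lemmas scaleC_diff_right = bounded_bilinear.diff_right[OF bounded_bilinear_scaleC]
lemmas scaleC_diff_left = bounded_bilinear.diff_left[OF bounded_bilinear_scaleC]

lemma scaleC_one [simp]: "1 *\<^sub>C (x :: 'a::complex_banach) = x"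
  using scaleR_scaleC[of 1 x] by simp

lemma scaleC_left_commute: "a *\<^sub>C b *\<^sub>C (x :: 'a::complex_banach) = b *\<^sub>C a *\<^sub>C x"
  by (simp add: scaleC_scaleC mult.commute)

text \<open>The rule \<open>orbit_shift\<close> needs nonnegative times; kernels vanishing on the
  negative half-line never test it elsewhere.\<close>

definition causal :: "(real \<Rightarrow> real) \<Rightarrow> bool" where
  "causal f \<longleftrightarrow> (\<forall>u<0. f u = 0)"

text \<open>A locale, because it is interpreted again for the rotated semigroup with the same
  \<open>M\<close>. The bound \<open>1 \<le> M\<close> allows division by \<open>M\<close>; it is
  arranged at the end by taking \<open>max 1 B\<close>.\<close>

locale bounded_C0_semigroup =
  fixes T :: "real \<Rightarrow> 'a::complex_banach \<Rightarrow> 'a" and M :: real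
  assumes C0: "C0_semigroup T" and M1: "1 \<le> M"
    and bound: "0 \<le> t \<Longrightarrow> norm (T t x) \<le> M * norm x"
begin

lemma T_linear: "0 \<le> t \<Longrightarrow> bounded_linear (T t)"
  and T_scaleC: "0 \<le> t \<Longrightarrow> T t (c *\<^sub>C x) = c *\<^sub>C T t x"
  and T_0 [simp]: "T 0 x = x"
  and T_add: "0 \<le> s \<Longrightarrow> 0 \<le> t \<Longrightarrow> T (s + t) x = T s (T t x)"
  and T_continuous: "continuous_on {0..} (\<lambda>t. T t x)"
  using C0 by (auto simp: C0_semigroup_def bounded_clinear_def)

lemma T_commute: "0 \<le> s \<Longrightarrow> 0 \<le> t \<Longrightarrow> T s (T t x) = T t (T s x)"
  using T_add[of s t x] T_add[of t s x] by (simp add: add.commute)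

text \<open>Constant continuation to negative times keeps the orbit bounded and continuous on the
  whole line, as \<open>bdd_cont\<close> asks.\<close>

definition orbit :: "'a \<Rightarrow> real \<Rightarrow> 'a" where
  "orbit x u = T (max u 0) x"

lemma bdd_cont_orbit: "bdd_cont (M * norm x) (orbit x)"
proof -
  have "continuous_on UNIV (\<lambda>u. T (max u 0) x)"
    by (rule continuous_on_compose2[OF T_continuous[of x]]) (auto intro!: continuous_intros)
  then show ?thesis using bound by (auto simp: bdd_cont_def orbit_def)
qed

lemma orbit_shift: "0 \<le> s \<Longrightarrow> 0 \<le> t \<Longrightarrow> orbit x (s + t) = T s (orbit x t)"
  by (simp add: orbit_def T_add)

lemma T_orbit: "0 \<le> s \<Longrightarrow> T s (orbit x t) = orbit (T s x) t"
  by (simp add: orbit_def T_commute)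

text \<open>The Hille-Phillips calculus of the semigroup, for nonnegative densities.\<close>

definition kop :: "(real \<Rightarrow> real) \<Rightarrow> 'a \<Rightarrow> 'a" where
  "kop f x = gint f (orbit x)"

context
  fixes f :: "real \<Rightarrow> real"
  assumes f: "kernel f"
begin

lemma kop_norm_le: "norm (kop f x) \<le> M * integral UNIV f * norm x"
  using gint_norm_le[OF f bdd_cont_orbit, of x "M * norm x"] bdd_cont_orbit[of x]
  unfolding kop_def bdd_cont_def by (simp add: mult_ac)

lemma T_kop: "0 \<le> t \<Longrightarrow> T t (kop f x) = kop f (T t x)"
  using gint_linear[OF f bdd_cont_orbit T_linear, of t x] by (simp add: kop_def T_orbit)

lemma kop_scaleC: "kop f (c *\<^sub>C x) = c *\<^sub>C kop f x"
proof -
  have "orbit (c *\<^sub>C x) = (\<lambda>u. c *\<^sub>C orbit x u)"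
    by (simp add: orbit_def T_scaleC fun_eq_iff)
  then show ?thesis
    using gint_linear[OF f bdd_cont_orbit bounded_linear_scaleC_right, of c x] by (simp add: kop_def)
qed

lemma kop_add: "kop f (x + y) = kop f x + kop f y"
proof -
  have "orbit (x + y) = (\<lambda>u. orbit x u + orbit y u)"
    by (simp add: orbit_def linear_simps(1)[OF T_linear] fun_eq_iff)
  then show ?thesis
    using gint_add[OF f bdd_cont_orbit bdd_cont_orbit, of x y] by (simp add: kop_def)
qed

lemma kop_linear: "bounded_linear (kop f)"
proof (rule bounded_linear_intro)
  show "norm (kop f x) \<le> norm x * (M * integral UNIV f)" for x
    using kop_norm_le[of x] by (simp add: mult_ac)
qed (auto simp: kop_add kop_scaleC scaleR_scaleC)

end

text \<open>Multiplicativity of the calculus: after moving \<open>T s\<close> inside the inner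
  integral it is \<open>gint_convolution\<close> for the orbit of \<open>x\<close>.\<close>

lemma kop_kop:
  assumes c: "convolves f g h" and "causal f" and "causal g"
  shows "kop f (kop g x) = kop h x"
proof -
  have g: "kernel g" using c by (simp add: convolves_def)
  have "gint f (orbit (kop g x)) = gint f (\<lambda>s. gint g (\<lambda>t. orbit x (s + t)))"
  proof (rule gint_cong)
    fix s assume "f s \<noteq> 0"
    with \<open>causal f\<close> have s: "0 \<le> s" by (meson causal_def not_le)
    have "orbit (kop g x) s = gint g (\<lambda>t. T s (orbit x t))"
      using s T_kop[OF g s] gint_linear[OF g bdd_cont_orbit T_linear[OF s]]
      by (simp add: orbit_def kop_def)
    also have "\<dots> = gint g (\<lambda>t. orbit x (s + t))"
      using \<open>causal g\<close> by (intro gint_cong) (metis causal_def not_le orbit_shift s)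
    finally show "orbit (kop g x) s = gint g (\<lambda>t. orbit x (s + t))" .
  qed
  then show ?thesis
    using gint_convolution[OF c bdd_cont_orbit] by (simp add: kop_def)
qed

lemma T_kop_shift:
  assumes g: "kernel g" and "causal g" and s: "0 \<le> s"
  shows "T s (kop g x) = kop (\<lambda>u. g (u - s)) x"
proof -
  have "T s (kop g x) = gint g (\<lambda>t. T s (orbit x t))"
    using gint_linear[OF g bdd_cont_orbit T_linear[OF s]] by (simp add: kop_def)
  also have "\<dots> = gint g (\<lambda>t. orbit x (s + t))"
    using \<open>causal g\<close> by (intro gint_cong) (metis causal_def not_le orbit_shift s)
  finally show ?thesis
    using gint_shift[OF g bdd_cont_orbit] by (simp add: kop_def)
qed

lemmas kop_add_kernel = gint_add_kernel[OF _ bdd_cont_orbit, folded kop_def]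
lemmas kop_cmult_kernel = gint_cmult_kernel[OF _ bdd_cont_orbit, folded kop_def]

section \<open>Fractional powers of the resolvent at one, and the generator\<close>

text \<open>\<open>J a\<close> is \<open>(I - A)\<^bsup>-a\<^esup>\<close>; in particular \<open>J 1\<close> is the resolvent at 1.\<close>

definition J :: "real \<Rightarrow> 'a \<Rightarrow> 'a" where
  "J a = kop (gamma_density a)"

lemma causal_gamma_density: "causal (gamma_density a)"
  by (simp add: causal_def gamma_density_def)

lemma J_linear: "0 < a \<Longrightarrow> bounded_linear (J a)"
  and J_scaleC: "0 < a \<Longrightarrow> J a (c *\<^sub>C x) = c *\<^sub>C J a x"
  and T_J: "0 < a \<Longrightarrow> 0 \<le> t \<Longrightarrow> T t (J a x) = J a (T t x)"
  unfolding J_def by (simp_all add: kernel_gamma_density kop_linear kop_scaleC T_kop)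

lemma J_J: "0 < a \<Longrightarrow> 0 < b \<Longrightarrow> J a (J b x) = J (a + b) x"
  unfolding J_def by (intro kop_kop gamma_density_convolution causal_gamma_density)

lemma J_eq: "J \<beta> x = neg_frac_power_shifted T \<beta> x"
proof -
  have "J \<beta> x = integral UNIV (\<lambda>u. if u \<in> {0<..} then ((u powr (\<beta> - 1) * exp (- u)) / Gamma \<beta>) *\<^sub>R T u x else 0)"
    unfolding J_def kop_def gint_def by (intro integral_cong) (auto simp: gamma_density_def orbit_def)
  also have "\<dots> = integral {0<..} (\<lambda>u. inverse (Gamma \<beta>) *\<^sub>R ((u powr (\<beta> - 1) * exp (- u)) *\<^sub>R T u x))"
    unfolding integral_restrict_UNIV by (intro integral_cong) (simp add: divide_inverse mult.commute)
  also have "\<dots> = neg_frac_power_shifted T \<beta> x"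
    unfolding neg_frac_power_shifted_def by (rule integral_cmul)
  finally show ?thesis .
qed

text \<open>The graph of the generator. As a relation it avoids the meaningless values of
  \<open>generator T\<close> outside the domain and keeps membership and value together.\<close>

definition gen :: "'a \<Rightarrow> 'a \<Rightarrow> bool" where
  "gen x y \<longleftrightarrow> ((\<lambda>h. (T h x - x) /\<^sub>R h) \<longlongrightarrow> y) (at_right 0)"

lemma genD: "gen x y \<Longrightarrow> x \<in> gen_domain T" "gen x y \<Longrightarrow> generator T x = y"
  unfolding gen_def gen_domain_def generator_def by (auto intro!: tendsto_Lim)

lemma gen_generator: "x \<in> gen_domain T \<Longrightarrow> gen x (generator T x)"
  using genD(2) unfolding gen_def gen_domain_def by auto

lemma gen_unique: "gen x y \<Longrightarrow> gen x z \<Longrightarrow> y = z"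
  using genD(2) by blast

lemma gen_add: "gen x y \<Longrightarrow> gen x' y' \<Longrightarrow> gen (x + x') (y + y')"
proof -
  assume "gen x y" "gen x' y'"
  then have lim: "((\<lambda>h. (T h x - x) /\<^sub>R h + (T h x' - x') /\<^sub>R h) \<longlongrightarrow> y + y') (at_right 0)"
    unfolding gen_def by (intro tendsto_intros)
  have "\<forall>\<^sub>F h in at_right 0. (T h x - x) /\<^sub>R h + (T h x' - x') /\<^sub>R h = (T h (x + x') - (x + x')) /\<^sub>R h"
    using eventually_at_right_less[of 0]
    by eventually_elim (simp add: linear_simps(1)[OF T_linear] algebra_simps)
  with lim show ?thesis unfolding gen_def by (rule Lim_transform_eventually)
qed

lemma gen_scaleC:
  assumes "gen x y" shows "gen (c *\<^sub>C x) (c *\<^sub>C y)"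
proof -
  have lim: "((\<lambda>h. c *\<^sub>C ((T h x - x) /\<^sub>R h)) \<longlongrightarrow> c *\<^sub>C y) (at_right 0)"
    using assms unfolding gen_def by (intro tendsto_scaleC tendsto_const)
  have "\<forall>\<^sub>F h in at_right 0. c *\<^sub>C ((T h x - x) /\<^sub>R h) = (T h (c *\<^sub>C x) - c *\<^sub>C x) /\<^sub>R h"
    using eventually_at_right_less[of 0]
    by eventually_elim
      (simp add: T_scaleC scaleR_scaleC scaleC_left_commute[of c] scaleC_diff_right)
  with lim show ?thesis unfolding gen_def by (rule Lim_transform_eventually)
qed

lemma gen_commute:
  assumes L: "bounded_linear L" and LT: "\<And>h x. 0 \<le> h \<Longrightarrow> T h (L x) = L (T h x)" and xy: "gen x y"
  shows "gen (L x) (L y)"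
proof -
  have lim: "((\<lambda>h. L ((T h x - x) /\<^sub>R h)) \<longlongrightarrow> L y) (at_right 0)"
    using xy unfolding gen_def by (rule bounded_linear.tendsto[OF L])
  have "\<forall>\<^sub>F h in at_right 0. L ((T h x - x) /\<^sub>R h) = (T h (L x) - L x) /\<^sub>R h"
    using eventually_at_right_less[of 0]
    by eventually_elim (simp add: LT linear_simps[OF L])
  with lim show ?thesis unfolding gen_def by (rule Lim_transform_eventually)
qed

text \<open>This is (I - A) J_1 = I. The exponential density is its own translate up to a factor, so
  \<open>T h (J 1 x)\<close> is \<open>exp h\<close> times \<open>J 1 x\<close> corrected by an
  integral over (0, h], and the difference quotient can be computed.\<close>

lemma gen_J1: "gen (J 1 x) (J 1 x - x)"
proof -
  define g where "g = gamma_density 1"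
  have g: "kernel g" unfolding g_def by (simp add: kernel_gamma_density)
  have geq: "g u = (if 0 < u then exp (- u) else 0)" for u
    by (simp add: g_def gamma_density_def)
  \<comment> \<open>\<open>max u 0\<close> prevents the growth of \<open>exp (- u)\<close> at
    negative \<open>u\<close>, so that \<open>F\<close> is bounded on the whole line.\<close>
  define F where "F u = exp (- max u 0) *\<^sub>R orbit x u" for u
  have F: "bdd_cont (M * norm x) F"
    using bdd_cont_orbit[of x] unfolding bdd_cont_def F_def
    by (auto intro!: continuous_intros mult_le_one order.trans[OF mult_left_le_one_le])
  have eq: "T h (J 1 x) = exp h *\<^sub>R (J 1 x - gint (indicator {0<..h}) F)" if h: "0 \<le> h" for h
  proof -
    define k where "k u = indicator {0<..h} u * g u" for u :: real
    have k: "kernel k"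
    proof -
      have "bdd_borel g"
        using kernel_measurable[OF g] unfolding bdd_borel_def by (auto simp: geq intro!: exI[of _ 1])
      then show ?thesis
        unfolding k_def by (rule kernel_mult[OF kernel_indicator_Ioc])
    qed
    have s: "kernel (\<lambda>u. g (u - h))"
      by (rule kernel_shift[OF g])
    have "exp (- h) * exp (- (u - h)) = exp (- u)" for u
      by (simp flip: exp_add)
    then have "g u = exp (- h) * g (u - h) + k u" for u
      using h by (auto simp: k_def geq indicator_def)
    then have "g = (\<lambda>u. exp (- h) * g (u - h) + k u)"
      by (rule ext)
    then have "J 1 x = kop (\<lambda>u. exp (- h) * g (u - h) + k u) x"
      unfolding J_def g_def[symmetric] by (rule arg_cong[where f = "\<lambda>f. kop f x"])
    also have "\<dots> = exp (- h) *\<^sub>R T h (J 1 x) + kop k x"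
      using T_kop_shift[OF g causal_gamma_density[of 1, folded g_def] h, of x]
      by (simp only: J_def g_def[symmetric] kop_add_kernel[OF kernel_cmult[OF s exp_ge_zero] k]
          kop_cmult_kernel[OF s])
    also have "kop k x = gint (indicator {0<..h}) F"
      unfolding kop_def gint_def by (intro integral_cong) (auto simp: k_def F_def geq indicator_def)
    finally have "J 1 x - gint (indicator {0<..h}) F = exp (- h) *\<^sub>R T h (J 1 x)"
      unfolding diff_eq_eq .
    then show ?thesis by (simp flip: exp_add)
  qed
  have e: "((\<lambda>h::real. (exp h - 1) / h) \<longlongrightarrow> 1) (at_right 0)"
    using DERIV_exp[of "0::real"] tendsto_mono[OF at_le[OF subset_UNIV, of 0 "{0<..}"]]
    by (simp add: DERIV_def)
  have "((\<lambda>h. ((exp h - 1) / h) *\<^sub>R J 1 x - exp h *\<^sub>R (gint (indicator {0<..h}) F /\<^sub>R h))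
      \<longlongrightarrow> 1 *\<^sub>R J 1 x - exp 0 *\<^sub>R F 0) (at_right 0)"
    by (intro tendsto_intros e gint_indicator_right_deriv[OF F])
  moreover have "F 0 = x" by (simp add: F_def orbit_def)
  ultimately have lim: "((\<lambda>h. ((exp h - 1) / h) *\<^sub>R J 1 x - exp h *\<^sub>R (gint (indicator {0<..h}) F /\<^sub>R h))
      \<longlongrightarrow> J 1 x - x) (at_right 0)" by simp
  have "\<forall>\<^sub>F h in at_right 0. ((exp h - 1) / h) *\<^sub>R J 1 x - exp h *\<^sub>R (gint (indicator {0<..h}) F /\<^sub>R h)
      = (T h (J 1 x) - J 1 x) /\<^sub>R h"
    using eventually_at_right_less[of 0]
    by eventually_elim (simp add: eq algebra_simps divide_inverse)
  with lim show ?thesis unfolding gen_def by (rule Lim_transform_eventually)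
qed

text \<open>The integrated semigroup, used to solve equations for A without assuming A
  invertible.\<close>

definition V :: "real \<Rightarrow> 'a \<Rightarrow> 'a" where
  "V t = kop (indicator {0<..t})"

lemma V_linear: "bounded_linear (V t)"
  and T_V: "0 \<le> h \<Longrightarrow> T h (V t x) = V t (T h x)"
  unfolding V_def by (simp_all add: kernel_indicator_Ioc kop_linear T_kop)

lemma T_V_shift: "0 \<le> s \<Longrightarrow> T s (V t x) = kop (indicator {s<..t + s}) x"
proof -
  assume "0 \<le> s"
  moreover have "(\<lambda>u. indicator {0<..t} (u - s)) = (indicator {s<..t + s} :: real \<Rightarrow> real)"
    by (intro ext) (auto simp: indicator_def)
  ultimately show ?thesis
    using T_kop_shift[OF kernel_indicator_Ioc, of 0 t s x] by (simp add: V_def causal_def)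
qed

text \<open>The increment \<open>T h (V t x) - V t x\<close> is symmetric in \<open>t\<close> and
  \<open>h\<close>: the intervals (h, t + h] and (0, h] cover the same range as (t, t + h] and (0,
  t]. Exchanging the roles turns the quotient into \<open>T t\<close> minus the identity, applied to
  \<open>V h x /\<^sub>R h\<close>, which tends to \<open>x\<close>.\<close>

lemma gen_V:
  assumes t: "0 \<le> t"
  shows "gen (V t x) (T t x - x)"
proof -
  have eq: "T h (V t x) - V t x = T t (V h x) - V h x" if h: "0 \<le> h" for h
  proof -
    have "(\<lambda>u. indicator {h<..t + h} u + indicator {0<..h} u)
        = (\<lambda>u. indicator {t<..h + t} u + indicator {0<..t} u :: real)"
      using t h by (intro ext) (auto simp: indicator_def)
    then have "kop (indicator {h<..t + h}) x + V h x = kop (indicator {t<..h + t}) x + V t x"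
      unfolding V_def by (simp add: kop_add_kernel[symmetric] kernel_indicator_Ioc)
    then show ?thesis
      using t h by (simp add: T_V_shift algebra_simps)
  qed
  have V0: "((\<lambda>h. V h x /\<^sub>R h) \<longlongrightarrow> x) (at_right 0)"
    using gint_indicator_right_deriv[OF bdd_cont_orbit, of x] by (simp add: V_def kop_def orbit_def)
  have lim: "((\<lambda>h. T t (V h x /\<^sub>R h) - V h x /\<^sub>R h) \<longlongrightarrow> T t x - x) (at_right 0)"
    by (intro tendsto_diff V0 bounded_linear.tendsto[OF T_linear[OF t]])
  have "\<forall>\<^sub>F h in at_right 0. T t (V h x /\<^sub>R h) - V h x /\<^sub>R h = (T h (V t x) - V t x) /\<^sub>R h"
    using eventually_at_right_less[of 0]
    by eventually_elim (simp add: eq linear_simps[OF T_linear[OF t]] scaleR_diff_right)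
  with lim show ?thesis unfolding gen_def by (rule Lim_transform_eventually)
qed

text \<open>A J_1 x is found in two ways, by commuting J_1 with A and by \<open>gen_J1\<close>;
  limits are unique. \<open>V_gen\<close> follows the same pattern.\<close>

lemma J1_gen: "gen x y \<Longrightarrow> J 1 y = J 1 x - x"
  using gen_unique[OF gen_commute[OF J_linear T_J] gen_J1] by simp

lemma V_gen: "gen x y \<Longrightarrow> 0 \<le> t \<Longrightarrow> V t y = T t x - x"
  using gen_unique[OF gen_commute[OF V_linear T_V] gen_V] by simp

end

section \<open>The imaginary axis\<close>

context bounded_C0_semigroup
begin

text \<open>Passing to e^(-ist) T(t) replaces A by A - is, which moves the point is of the spectrum
  to 0.\<close>

lemma rotate: "bounded_C0_semigroup (\<lambda>t x. cis (- (s * t)) *\<^sub>C T t x) M"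
proof
  have "bounded_linear (\<lambda>x. cis (- (s * t)) *\<^sub>C T t x)" if "0 \<le> t" for t
    using bounded_linear_compose[OF bounded_linear_scaleC_right T_linear[OF that]] .
  moreover have "cis (- (s * (u + t))) *\<^sub>C T (u + t) x = cis (- (s * u)) *\<^sub>C T u (cis (- (s * t)) *\<^sub>C T t x)"
    if "0 \<le> u" "0 \<le> t" for u t x
    using that by (simp add: T_scaleC T_add T_commute[of t u] scaleC_scaleC cis_mult algebra_simps)
  ultimately show "C0_semigroup (\<lambda>t x. cis (- (s * t)) *\<^sub>C T t x)"
    unfolding C0_semigroup_def bounded_clinear_def
    by (auto simp: T_scaleC scaleC_left_commute intro!: continuous_on_scaleC continuous_intros T_continuous
        continuous_on_compose2[OF continuous_on_cis, of UNIV])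
  show "norm (cis (- (s * t)) *\<^sub>C T t x) \<le> M * norm x" if "0 \<le> t" for t x
    using bound[OF that, of x] by (simp add: norm_scaleC)
qed (rule M1)

text \<open>The product rule at 0, with T(h) written as e^(ish) times the rotated semigroup.\<close>

lemma gen_rotate:
  assumes "bounded_C0_semigroup.gen (\<lambda>t x. cis (- (s * t)) *\<^sub>C T t x) x y"
  shows "gen x (y + (\<i> * complex_of_real s) *\<^sub>C x)"
proof -
  interpret S: bounded_C0_semigroup "\<lambda>t x. cis (- (s * t)) *\<^sub>C T t x" M by (rule rotate)
  have "((\<lambda>z. exp (\<i> * complex_of_real s * z)) has_field_derivative \<i> * complex_of_real s) (at 0)"
    by (auto intro!: derivative_eq_intros)
  then have d: "((\<lambda>z. (exp (\<i> * complex_of_real s * z) - 1) / z) \<longlongrightarrow> \<i> * complex_of_real s) (at 0)"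
    by (simp add: DERIV_def)
  have "filterlim complex_of_real (at 0) (at_right 0)"
    by (auto simp: filterlim_at eventually_at_filter intro!: tendsto_eq_intros)
  from filterlim_compose[OF d this]
  have c: "((\<lambda>h. (cis (s * h) - 1) /\<^sub>R h) \<longlongrightarrow> \<i> * complex_of_real s) (at_right 0)"
    by (simp add: cis_conv_exp scaleR_conv_of_real divide_inverse mult_ac)
  have e: "((\<lambda>h. cis (s * h)) \<longlongrightarrow> cis (s * 0)) (at_right 0)"
    by (intro tendsto_intros)
  have lim: "((\<lambda>h. cis (s * h) *\<^sub>C ((cis (- (s * h)) *\<^sub>C T h x - x) /\<^sub>R h) + ((cis (s * h) - 1) /\<^sub>R h) *\<^sub>C x)
     \<longlongrightarrow> y + (\<i> * complex_of_real s) *\<^sub>C x) (at_right 0)"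
    using tendsto_add[OF tendsto_scaleC[OF e assms[unfolded S.gen_def]] tendsto_scaleC[OF c tendsto_const, of x]] by simp
  have "cis (s * h) *\<^sub>C ((cis (- (s * h)) *\<^sub>C T h x - x) /\<^sub>R h) + ((cis (s * h) - 1) /\<^sub>R h) *\<^sub>C x = (T h x - x) /\<^sub>R h" for h
  proof -
    have "cis (s * h) *\<^sub>C ((cis (- (s * h)) *\<^sub>C T h x - x) /\<^sub>R h)
        = (cis (s * h) *\<^sub>C cis (- (s * h)) *\<^sub>C T h x - cis (s * h) *\<^sub>C x) /\<^sub>R h"
      by (simp add: bounded_bilinear.scaleR_right[OF bounded_bilinear_scaleC] scaleC_diff_right)
    then show ?thesis
      by (simp add: bounded_bilinear.scaleR_left[OF bounded_bilinear_scaleC] scaleC_diff_left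
          scaleC_scaleC cis_mult scaleR_diff_right)
  qed
  with lim show ?thesis unfolding gen_def by simp
qed

text \<open>The converse is \<open>gen_rotate\<close> for the rotated semigroup, rotated back by
  \<open>- s\<close>.\<close>

lemma gen_rotate_iff:
  "bounded_C0_semigroup.gen (\<lambda>t x. cis (- (s * t)) *\<^sub>C T t x) x y \<longleftrightarrow> gen x (y + (\<i> * complex_of_real s) *\<^sub>C x)"
proof
  assume g: "gen x (y + (\<i> * complex_of_real s) *\<^sub>C x)"
  interpret S: bounded_C0_semigroup "\<lambda>t x. cis (- (s * t)) *\<^sub>C T t x" M by (rule rotate)
  have "(\<lambda>t x. cis (- (- s * t)) *\<^sub>C cis (- (s * t)) *\<^sub>C T t x) = T"
    by (simp add: scaleC_scaleC cis_mult)
  then show "S.gen x y"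
    using S.gen_rotate[of "- s" x "y + (\<i> * complex_of_real s) *\<^sub>C x"] g
    by (simp add: bounded_bilinear.minus_left[OF bounded_bilinear_scaleC])
qed (rule gen_rotate)

text \<open>With \<open>S t = e\<^bsup>-ist\<^esup> T t\<close>, \<open>V t x\<close> the integral of \<open>S u x\<close> over \<open>0 < u \<le> t\<close> and
  \<open>\<mu> = i s\<close>, the operator \<open>U = (1 - \<mu>) V t J 1 + J 1\<close> inverts \<open>\<mu> - A\<close> up to
  \<open>Q = (1 - \<mu>) S t J 1\<close>, which is a strict contraction once \<open>T t J 1\<close> is small.\<close>

lemma imaginary_in_resolvent_set:
  assumes t: "0 \<le> t" and q: "\<And>x. norm (T t (J 1 x)) \<le> q * norm x"
    and less: "cmod (1 - \<i> * complex_of_real s) * q < 1" and q0: "0 \<le> q"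
  shows "\<i> * complex_of_real s \<in> resolvent_set (gen_domain T) (generator T)"
proof -
  interpret S: bounded_C0_semigroup "\<lambda>t x. cis (- (s * t)) *\<^sub>C T t x" M by (rule rotate)
  define \<mu> where "\<mu> = \<i> * complex_of_real s"
  define Q where "Q x = (1 - \<mu>) *\<^sub>C cis (- (s * t)) *\<^sub>C T t (J 1 x)" for x
  \<comment> \<open>With A the generator, J_1 (\<mu> - A) x = x - (1 - \<mu>) J_1 x, while the
    integrated rotated semigroup sends (\<mu> - A) J_1 x to J_1 x - S(t) J_1 x. Adding (1 - \<mu>)
    times the second cancels (1 - \<mu>) J_1 x and leaves x - Q x.\<close>
  define U where "U z = (1 - \<mu>) *\<^sub>C S.V t (J 1 z) + J 1 z" for z
  define r where "r = cmod (1 - \<mu>) * q"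
  define A where "A x = \<mu> *\<^sub>C x - generator T x" for x
  have r: "0 \<le> r" "r < 1" using less q0 by (auto simp: r_def \<mu>_def)
  have J: "bounded_linear (J 1)" by (simp add: J_linear)
  have U_lin: "bounded_linear U"
    unfolding U_def
    by (intro bounded_linear_add J bounded_linear_compose[OF bounded_linear_scaleC_right]
        bounded_linear_compose[OF S.V_linear])
  have Q_lin: "bounded_linear Q"
    unfolding Q_def
    by (intro J bounded_linear_compose[OF bounded_linear_scaleC_right]
        bounded_linear_compose[OF T_linear[OF t]])
  have Q_le: "norm (Q x) \<le> r * norm x" for x
    using mult_left_mono[OF q[of x], of "cmod (1 - \<mu>)"] by (simp add: Q_def r_def norm_scaleC mult.assoc)
  have UA: "U (A x) = x - Q x" if x: "x \<in> gen_domain T" for x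
  proof -
    define y where "y = generator T x"
    have xy: "gen x y" unfolding y_def by (rule gen_generator[OF x])
    have JA: "J 1 (A x) = x - (1 - \<mu>) *\<^sub>C J 1 x"
      using J1_gen[OF xy]
      by (simp add: A_def y_def linear_simps[OF J] J_scaleC scaleC_diff_left)
    have "gen (J 1 x) (J 1 y)" by (rule gen_commute[OF J T_J xy]) auto
    then have "S.gen (J 1 x) (J 1 y - \<mu> *\<^sub>C J 1 x)"
      by (simp add: gen_rotate_iff \<mu>_def)
    moreover have "J 1 y - \<mu> *\<^sub>C J 1 x = - J 1 (A x)"
      by (simp add: A_def y_def linear_simps[OF J] J_scaleC)
    ultimately have "S.V t (J 1 (A x)) = J 1 x - cis (- (s * t)) *\<^sub>C T t (J 1 x)"
      using S.V_gen[OF _ t, of "J 1 x" "- J 1 (A x)"] by (simp add: linear_simps[OF S.V_linear] minus_equation_iff)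
    then show ?thesis
      by (simp add: U_def JA Q_def scaleC_diff_right)
  qed
  have AU: "gen (U z) (\<mu> *\<^sub>C U z - (z - Q z))" for z
  proof -
    have "gen (S.V t (J 1 z)) (cis (- (s * t)) *\<^sub>C T t (J 1 z) - J 1 z + \<mu> *\<^sub>C S.V t (J 1 z))"
      using S.gen_V[OF t, of "J 1 z"] by (simp add: gen_rotate_iff \<mu>_def)
    then have "gen (U z) ((1 - \<mu>) *\<^sub>C (cis (- (s * t)) *\<^sub>C T t (J 1 z) - J 1 z + \<mu> *\<^sub>C S.V t (J 1 z)) + (J 1 z - z))"
      unfolding U_def by (intro gen_add gen_scaleC gen_J1)
    moreover have "(1 - \<mu>) *\<^sub>C (cis (- (s * t)) *\<^sub>C T t (J 1 z) - J 1 z + \<mu> *\<^sub>C S.V t (J 1 z)) + (J 1 z - z)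
        = \<mu> *\<^sub>C U z - (z - Q z)"
    proof -
      define c where "c = 1 - \<mu>"
      have "c *\<^sub>C J 1 z = J 1 z - \<mu> *\<^sub>C J 1 z"
        by (simp add: c_def scaleC_diff_left)
      then show ?thesis
        unfolding U_def Q_def c_def[symmetric] scaleC_diff_right scaleC_add_right
          scaleC_left_commute[of c \<mu>] by simp
    qed
    ultimately show ?thesis by simp
  qed
  have U_dom: "U z \<in> gen_domain T" and AU': "A (U z) = z - Q z" for z
    using genD[OF AU[of z]] by (auto simp: A_def)
  have lower: "(1 - r) * norm x \<le> norm (x - Q x)" for x
    using Q_le[of x] norm_triangle_ineq2[of x "Q x"] by (simp add: algebra_simps)
  obtain K where K: "\<And>z. norm (U z) \<le> norm z * K" "K > 0"
    using bounded_linear.pos_bounded[OF U_lin] by blast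
  have A_lower: "(1 - r) * norm x \<le> K * norm (A x)" if "x \<in> gen_domain T" for x
    using lower[of x] K(1)[of "A x"] UA[OF that] by (simp add: mult.commute)
  have A_add: "x + y \<in> gen_domain T" "A (x + y) = A x + A y"
    if "x \<in> gen_domain T" "y \<in> gen_domain T" for x y
    using genD[OF gen_add[OF gen_generator[OF that(1)] gen_generator[OF that(2)]]]
    by (auto simp: A_def scaleC_add_right)
  have A_scaleC: "c *\<^sub>C x \<in> gen_domain T" "A (c *\<^sub>C x) = c *\<^sub>C A x"
    if "x \<in> gen_domain T" for c x
    using genD[OF gen_scaleC[OF gen_generator[OF that], of c]]
    by (auto simp: A_def scaleC_diff_right scaleC_left_commute)
  have inj: "inj_on A (gen_domain T)"
  proof (rule inj_onI)
    fix x y assume x: "x \<in> gen_domain T" and y: "y \<in> gen_domain T" and eq: "A x = A y"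
    have "x - Q x = y - Q y" using UA[OF x] UA[OF y] eq by simp
    then have "(x - y) - Q (x - y) = 0" by (simp add: linear_simps[OF Q_lin] algebra_simps)
    then have "(1 - r) * norm (x - y) \<le> 0" using lower[of "x - y"] by simp
    then show "x = y" using r by (simp add: mult_le_0_iff)
  qed
  have surj: "\<exists>x\<in>gen_domain T. A x = z" for z
  proof -
    \<comment> \<open>The Neumann series in the form of a fixed point: y - Q y = z, hence
      \<open>U y\<close> is a preimage of \<open>z\<close>.\<close>
    have "\<exists>!y. z + Q y = y"
    proof (rule banach_fix_type[OF r], intro allI)
      fix x y show "dist (z + Q x) (z + Q y) \<le> r * dist x y"
        using Q_le[of "x - y"] by (simp add: dist_norm linear_simps[OF Q_lin])
    qed
    then obtain y where "z + Q y = y" by blast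
    then have "A (U y) = z" by (simp add: AU' algebra_simps)
    then show ?thesis using U_dom by blast
  qed
  have bij: "bij_betw A (gen_domain T) UNIV"
    unfolding bij_betw_def using inj surj by (auto simp: image_iff) metis
  define R where "R = inv_into (gen_domain T) A"
  have R: "R z \<in> gen_domain T" "A (R z) = z" for z
    using bij_betw_inv_into_right[OF bij, of z] bij_betw_imp_surj_on[OF bij_betw_inv_into[OF bij]]
    by (auto simp: R_def)
  have RI: "R z = x" if "x \<in> gen_domain T" "A x = z" for x z
    using inv_into_f_f[OF inj that(1)] that(2) by (simp add: R_def)
  have R_add: "R (x + y) = R x + R y" for x y
    by (intro RI) (simp_all add: A_add R)
  have R_scaleC: "R (c *\<^sub>C x) = c *\<^sub>C R x" for c x
    by (intro RI) (simp_all add: A_scaleC R)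
  have "bounded_linear R"
  proof (rule bounded_linear_intro)
    show "norm (R z) \<le> norm z * (K / (1 - r))" for z
      using A_lower[OF R(1), of z] r by (simp add: R field_simps)
  qed (auto simp: R_add R_scaleC scaleR_scaleC)
  with R_scaleC bij show ?thesis
    unfolding resolvent_set_def bounded_clinear_def A_def R_def \<mu>_def by blast
qed

end

section \<open>The moment inequality\<close>

lemma kernel_mono:
  assumes g: "kernel g" and f: "f \<in> borel_measurable borel" and le: "\<And>u. 0 \<le> f u" "\<And>u. f u \<le> g u"
  shows "kernel f" and "integral UNIV f \<le> integral UNIV g"
proof -
  have le_nn: "(\<integral>\<^sup>+u. f u \<partial>lborel) \<le> (\<integral>\<^sup>+u. g u \<partial>lborel)"
    by (intro nn_integral_mono ennreal_leI le)
  with kernel_finite[OF g] f le show k: "kernel f"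
    by (auto simp: kernel_def)
  show "integral UNIV f \<le> integral UNIV g"
    by (rule has_integral_le[OF kernel_has_integral(1)[OF k] kernel_has_integral(1)[OF g]]) (rule le)
qed

lemma kernel_restrict:
  assumes f: "f \<in> borel_measurable borel" "\<And>u. 0 \<le> f u" "\<And>u. u \<notin> S \<Longrightarrow> f u = 0"
    and g: "(g has_integral I) S" and eq: "\<And>u. u \<in> S \<Longrightarrow> f u = g u"
  shows "kernel f" and "integral UNIV f = I"
proof -
  have "(f has_integral I) S"
    using g eq by (metis has_integral_cong)
  then have I: "(f has_integral I) UNIV"
    using f(3) by (rule has_integral_on_superset) auto
  then show "integral UNIV f = I" by (rule integral_unique)
  show "kernel f"
    using f nn_integral_has_integral_lborel[OF f(1,2) I] by (simp add: kernel_def)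
qed

context bounded_C0_semigroup
begin

text \<open>With \<open>k(u) = u\<^bsup>a-1\<^esup> / \<Gamma>(a)\<close> the density of \<open>J a\<close> is \<open>k(u) e\<^bsup>-u\<^esup>\<close>; beyond \<open>\<epsilon>\<close> it equals
  \<open>k(\<epsilon>) e\<^bsup>-u\<^esup>\<close> minus the convolution of \<open>- k'(u) e\<^bsup>-u\<^esup>\<close>, restricted to \<open>u > \<epsilon>\<close>, with \<open>e\<^bsup>-u\<^esup>\<close>, and
  so factors through \<open>J 1\<close>.\<close>

lemma J_split:
  assumes a: "0 < a" "a < 1" and \<epsilon>: "0 < \<epsilon>"
  shows "norm (J a x) \<le> M / (a * Gamma a) * (\<epsilon> powr a * norm x)
           + (1 + M) / Gamma a * (\<epsilon> powr (a - 1) * norm (J 1 x))"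
proof -
  have G: "Gamma a > 0" using a by (simp add: Gamma_real_pos)
  \<comment> \<open>Relative to \<open>\<epsilon> powr (a - 1) * exp (- u) / Gamma a\<close>, the
    function \<open>\<rho>\<close> is the excess of the density up to \<open>\<epsilon>\<close> and
    \<open>c\<close> its deficit beyond \<open>\<epsilon>\<close>; \<open>q\<close> is chosen so
    that its convolution with the density of \<open>J 1\<close> is \<open>c\<close>.\<close>
  define \<rho> where "\<rho> u = (if 0 < u \<and> u \<le> \<epsilon> then (u powr (a - 1) - \<epsilon> powr (a - 1)) * exp (- u) / Gamma a else 0)" for u
  define q where "q u = (if \<epsilon> < u then (1 - a) * u powr (a - 2) * exp (- u) / Gamma a else 0)" for u
  define c where "c u = (if \<epsilon> < u then (\<epsilon> powr (a - 1) - u powr (a - 1)) * exp (- u) / Gamma a else 0)" for u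
  have [measurable]: "\<rho> \<in> borel_measurable borel" "q \<in> borel_measurable borel" "c \<in> borel_measurable borel"
    unfolding \<rho>_def q_def c_def by measurable
  have anti: "v powr (a - 1) \<le> u powr (a - 1)" if "0 < u" "u \<le> v" for u v
    using powr_mono2'[of "a - 1" u v] a that by simp
  have nonneg: "0 \<le> \<rho> u" "0 \<le> q u" "0 \<le> c u" for u
    using anti[of u \<epsilon>] anti[of \<epsilon> u] a G \<epsilon> by (auto simp: \<rho>_def q_def c_def)
  have k1: "kernel (gamma_density 1)" by (simp add: kernel_gamma_density)
  have d1: "gamma_density 1 u = (if 0 < u then exp (- u) else 0)" for u
    by (simp add: gamma_density_def)
  \<comment> \<open>The majorants \<open>\<rho>'\<close> and, below, \<open>q'\<close> drop the
    exponential so that the masses are integrals of pure powers.\<close>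
  define \<rho>' where "\<rho>' u = (if 0 < u \<and> u \<le> \<epsilon> then u powr (a - 1) / Gamma a else 0)" for u
  have \<rho>'m: "\<rho>' \<in> borel_measurable borel" unfolding \<rho>'_def by measurable
  have "((\<lambda>u. u powr (a - 1) / Gamma a) has_integral \<epsilon> powr (a - 1 + 1) / (a - 1 + 1) / Gamma a) {0..\<epsilon>}"
    using a \<epsilon> by (intro has_integral_divide has_integral_powr_from_0) auto
  then have \<rho>': "kernel \<rho>'" "integral UNIV \<rho>' = \<epsilon> powr (a - 1 + 1) / (a - 1 + 1) / Gamma a"
    by (rule kernel_restrict[OF \<rho>'m, rotated 2]; use G in \<open>auto simp: \<rho>'_def\<close>)+
  have "\<rho> u \<le> \<rho>' u" for u
  proof -
    have "(u powr (a - 1) - \<epsilon> powr (a - 1)) * exp (- u) \<le> u powr (a - 1) * 1" if "0 < u" "u \<le> \<epsilon>"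
      using anti[OF that] that by (intro mult_mono) auto
    then show ?thesis using G by (auto simp: \<rho>_def \<rho>'_def divide_right_mono)
  qed
  from kernel_mono[OF \<rho>'(1) _ nonneg(1) this] have \<rho>: "kernel \<rho>" "integral UNIV \<rho> \<le> \<epsilon> powr a / (a * Gamma a)"
    using \<rho>'(2) by (auto simp: divide_simps)
  define q' where "q' u = (if \<epsilon> \<le> u then (1 - a) / Gamma a * u powr (a - 2) else 0)" for u
  have q'm: "q' \<in> borel_measurable borel" unfolding q'_def by measurable
  have "((\<lambda>u. (1 - a) / Gamma a * u powr (a - 2)) has_integral
      (1 - a) / Gamma a * (- (\<epsilon> powr (a - 2 + 1)) / (a - 2 + 1))) {\<epsilon>..}"
    using a \<epsilon> by (intro has_integral_mult_right has_integral_powr_to_inf) auto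
  then have q': "kernel q'" "integral UNIV q' = (1 - a) / Gamma a * (- (\<epsilon> powr (a - 2 + 1)) / (a - 2 + 1))"
    by (rule kernel_restrict[OF q'm, rotated 2]; use G a in \<open>auto simp: q'_def\<close>)+
  have "q u \<le> q' u" for u
  proof -
    have "(1 - a) * u powr (a - 2) * exp (- u) \<le> (1 - a) * u powr (a - 2) * 1" if "\<epsilon> < u"
      using that \<epsilon> a by (intro mult_left_mono) auto
    then show ?thesis using G a by (auto simp: q_def q'_def divide_right_mono)
  qed
  from kernel_mono[OF q'(1) _ nonneg(2) this] have *: "kernel q" "integral UNIV q \<le> integral UNIV q'"
    by auto
  have q: "kernel q" "integral UNIV q \<le> \<epsilon> powr (a - 1) / Gamma a"
  proof -
    have e: "a - 2 + 1 = - (1 - a)" by simp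
    have "integral UNIV q' = (1 - a) / Gamma a * (\<epsilon> powr (- (1 - a)) / (1 - a))"
      unfolding q'(2) e minus_divide_divide ..
    also have "\<dots> = \<epsilon> powr (a - 1) / Gamma a" using a by simp
    finally show "integral UNIV q \<le> \<epsilon> powr (a - 1) / Gamma a" "kernel q"
      using * by auto
  qed
  have kc: "kernel c"
  proof (rule kernel_mono(1))
    show "kernel (\<lambda>u. \<epsilon> powr (a - 1) / Gamma a * gamma_density 1 u)"
      using G by (intro kernel_cmult k1) auto
    show "c u \<le> \<epsilon> powr (a - 1) / Gamma a * gamma_density 1 u" for u
    proof -
      have "(\<epsilon> powr (a - 1) - u powr (a - 1)) * exp (- u) \<le> \<epsilon> powr (a - 1) * exp (- u)"
        by (intro mult_right_mono) auto
      then show ?thesis using G \<epsilon> by (auto simp: c_def d1 divide_right_mono)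
    qed
  qed (use nonneg in auto)
  have "(\<integral>\<^sup>+s. ennreal (q s * gamma_density 1 (u - s)) \<partial>lborel) = ennreal (c u)" for u
  proof (cases "\<epsilon> < u")
    case False
    then have z: "q s * gamma_density 1 (u - s) = 0" for s
      by (auto simp: q_def d1)
    show ?thesis using False unfolding z by (simp add: c_def)
  next
    case True
    define w where "w s = (1 - a) * s powr (a - 2) * (exp (- u) / Gamma a)" for s
    \<comment> \<open>The product of exponentials is independent of \<open>s\<close>, so a pure
      power remains. The integrand is zero at the endpoints while \<open>w\<close> is not, hence
      equality only almost everywhere.\<close>
    have "AE s in lborel. ennreal (q s * gamma_density 1 (u - s)) = ennreal (w s) * indicator {\<epsilon>..u} s"
    proof -
      have "AE s in lborel. s \<noteq> \<epsilon> \<and> s \<noteq> u"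
        using AE_lborel_singleton[of \<epsilon>] AE_lborel_singleton[of u] by eventually_elim simp
      then show ?thesis
      proof eventually_elim
        case (elim s)
        have "exp (- s) * exp (- (u - s)) = exp (- u)" by (simp flip: exp_add)
        then have "(1 - a) * s powr (a - 2) * exp (- s) / Gamma a * exp (- (u - s)) = w s"
          by (simp add: w_def)
        then show ?case using elim by (auto simp: q_def d1)
      qed
    qed
    then have "(\<integral>\<^sup>+s. ennreal (q s * gamma_density 1 (u - s)) \<partial>lborel) = (\<integral>\<^sup>+s. ennreal (w s) * indicator {\<epsilon>..u} s \<partial>lborel)"
      by (rule nn_integral_cong_AE)
    also have "\<dots> = ennreal (- (u powr (a - 1)) * (exp (- u) / Gamma a) - (- (\<epsilon> powr (a - 1)) * (exp (- u) / Gamma a)))"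
    proof (rule nn_integral_FTC_Icc[where F = "\<lambda>s. - (s powr (a - 1)) * (exp (- u) / Gamma a)"])
      show "w \<in> borel_measurable borel" unfolding w_def by measurable
      fix s assume s: "s \<in> {\<epsilon>..u}"
      show "0 \<le> w s" using a G by (simp add: w_def)
      have "((\<lambda>s. - (s powr (a - 1)) * (exp (- u) / Gamma a)) has_real_derivative
          - ((a - 1) * s powr (a - 1 - 1)) * (exp (- u) / Gamma a)) (at s)"
        using s \<epsilon> by (intro DERIV_cmult_right DERIV_minus has_real_derivative_powr) auto
      then show "((\<lambda>s. - (s powr (a - 1)) * (exp (- u) / Gamma a)) has_real_derivative w s) (at s)"
        by (simp add: w_def algebra_simps)
    qed (use True in auto)
    also have "\<dots> = ennreal (c u)"
      using True by (simp add: c_def algebra_simps diff_divide_distrib)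
    finally show ?thesis .
  qed
  then have conv: "convolves q (gamma_density 1) c"
    using q(1) kc k1 by (simp add: convolves_def)
  have "causal q" using \<epsilon> by (simp add: causal_def q_def)
  from kop_kop[OF conv this causal_gamma_density] have kq: "kop q (J 1 x) = kop c x"
    by (simp add: J_def)
  have split: "gamma_density a u + c u = \<rho> u + \<epsilon> powr (a - 1) / Gamma a * gamma_density 1 u" for u
    using \<epsilon> by (auto simp: d1 gamma_density_def \<rho>_def c_def diff_divide_distrib left_diff_distrib)
  have "J a x + kop c x = kop (\<lambda>u. gamma_density a u + c u) x"
    using a kc by (simp add: kop_add_kernel kernel_gamma_density J_def)
  also have "\<dots> = kop \<rho> x + (\<epsilon> powr (a - 1) / Gamma a) *\<^sub>R J 1 x"
  proof -
    have "0 \<le> \<epsilon> powr (a - 1) / Gamma a" using G by simp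
    from kop_add_kernel[OF \<rho>(1) kernel_cmult[OF k1 this]] show ?thesis
      unfolding split J_def kop_cmult_kernel[OF k1] .
  qed
  finally have "J a x = kop \<rho> x + (\<epsilon> powr (a - 1) / Gamma a) *\<^sub>R J 1 x - kop q (J 1 x)"
    by (simp add: kq algebra_simps)
  \<comment> \<open>In the constant \<open>(1 + M) / Gamma a\<close> the 1 comes from the multiple
    of \<open>J 1 x\<close> and the \<open>M\<close> from \<open>kop q (J 1 x)\<close>.\<close>
  then have "norm (J a x) \<le> norm (kop \<rho> x) + norm ((\<epsilon> powr (a - 1) / Gamma a) *\<^sub>R J 1 x) + norm (kop q (J 1 x))"
    by (metis norm_triangle_le_diff norm_triangle_ineq add_right_mono order_trans norm_triangle_ineq4)
  also have "norm (kop \<rho> x) \<le> M * (\<epsilon> powr a / (a * Gamma a)) * norm x"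
    using M1 by (intro order.trans[OF kop_norm_le[OF \<rho>(1)]] mult_right_mono mult_left_mono \<rho>(2)) auto
  also have "norm (kop q (J 1 x)) \<le> M * (\<epsilon> powr (a - 1) / Gamma a) * norm (J 1 x)"
    using M1 by (intro order.trans[OF kop_norm_le[OF q(1)]] mult_right_mono mult_left_mono q(2)) auto
  also have "norm ((\<epsilon> powr (a - 1) / Gamma a) *\<^sub>R J 1 x) = \<epsilon> powr (a - 1) / Gamma a * norm (J 1 x)"
    using G by simp
  finally show ?thesis by (simp add: algebra_simps add_divide_distrib)
qed

text \<open>If J_1 x = 0, then \<open>gen_J1\<close> gives A 0 = -x, and A 0 = 0.\<close>

lemma J1_inj: "J 1 x = 0 \<Longrightarrow> x = 0"
proof -
  assume "J 1 x = 0"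
  then have "gen 0 (- x)" using gen_J1[of x] by simp
  moreover have "gen 0 0" using gen_J1[of 0] by (simp add: linear_simps(3)[OF J_linear])
  ultimately show "x = 0" using gen_unique by fastforce
qed

text \<open>A zero of J_a is a zero of J_n for every integer n > a, and J_n is a power of the
  injective J_1.\<close>

lemma J_inj:
  assumes a: "0 < a" and 0: "J a x = 0"
  shows "x = 0"
proof -
  have Jn: "y = 0" if "J (real (Suc n)) y = 0" for n y
    using that
  proof (induction n arbitrary: y)
    case 0
    then show ?case by (simp add: J1_inj)
  next
    case (Suc n)
    have "J 1 (J (real (Suc n)) y) = J (real (Suc (Suc n))) y"
      by (subst J_J) (simp_all add: add.commute)
    then show ?case using Suc J1_inj by metis
  qed
  obtain n where n: "a < real (Suc n)"
    using reals_Archimedean2[of a] by (metis less_trans lessI of_nat_less_iff)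
  have "J (real (Suc n)) x = J (real (Suc n) - a) (J a x)"
    using a n by (subst J_J) auto
  also have "\<dots> = 0" using n by (simp add: 0 linear_simps(3)[OF J_linear])
  finally show ?thesis by (rule Jn)
qed

text \<open>Choosing \<open>\<epsilon>\<close> as the ratio of \<open>norm (J 1 x)\<close> to
  \<open>norm x\<close> makes the two powers in \<open>J_split\<close> equal. Injectivity keeps the
  logarithms meaningful.\<close>

lemma moment_less_1:
  assumes a: "0 < a" "a < 1"
  shows "\<exists>C. \<forall>x. x \<noteq> 0 \<longrightarrow> ln (norm (J a x)) \<le> C + (1 - a) * ln (norm x) + a * ln (norm (J 1 x))"
proof (intro exI allI impI)
  fix x :: 'a assume x: "x \<noteq> 0"
  define N where "N = norm x"
  define N1 where "N1 = norm (J 1 x)"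
  have pos: "0 < N" "0 < N1" "0 < norm (J a x)"
    using x J1_inj[of x] J_inj[OF a(1), of x] by (auto simp: N_def N1_def)
  define \<epsilon> where "\<epsilon> = N1 / N"
  have e: "\<epsilon> powr a * N = N powr (1 - a) * N1 powr a" "\<epsilon> powr (a - 1) * N1 = N powr (1 - a) * N1 powr a"
    using pos by (auto simp: \<epsilon>_def powr_divide powr_diff powr_minus field_simps)
  define C where "C = M / (a * Gamma a) + (1 + M) / Gamma a"
  have C: "C > 0" using M1 a by (auto simp: C_def Gamma_real_pos intro!: add_pos_pos divide_pos_pos mult_pos_pos)
  have "norm (J a x) \<le> M / (a * Gamma a) * (\<epsilon> powr a * N) + (1 + M) / Gamma a * (\<epsilon> powr (a - 1) * N1)"
    unfolding N_def N1_def by (rule J_split[OF a]) (use pos in \<open>simp add: \<epsilon>_def\<close>)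
  also have "\<dots> = C * (N powr (1 - a) * N1 powr a)"
    unfolding e by (simp add: C_def algebra_simps)
  finally have "ln (norm (J a x)) \<le> ln (C * (N powr (1 - a) * N1 powr a))"
    using pos C by (intro ln_mono) auto
  also have "\<dots> = ln C + (1 - a) * ln N + a * ln N1"
    using C pos by (simp add: ln_mult ln_powr)
  finally show "ln (norm (J a x)) \<le> ln (M / (a * Gamma a) + (1 + M) / Gamma a) + (1 - a) * ln (norm x) + a * ln (norm (J 1 x))"
    by (simp add: C_def N_def N1_def)
qed

text \<open>The moment inequality in logarithmic form, where combining instances of it becomes
  linear elimination.\<close>

definition moment_bound :: "real \<Rightarrow> bool" where
  "moment_bound g \<longleftrightarrow>
     (\<exists>C. \<forall>x. x \<noteq> 0 \<longrightarrow> g * ln (norm (J 1 x)) \<le> C + (g - 1) * ln (norm x) + ln (norm (J g x)))"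

text \<open>Three inequalities are combined: the bound for \<open>g\<close> at \<open>J d x\<close>,
  the interpolation for \<open>1 - d\<close> at \<open>J d x\<close>, which speaks of
  \<open>J 1 x\<close>, and the interpolation for \<open>d\<close> at \<open>x\<close>. Eliminating
  \<open>E\<close> and \<open>D\<close> leaves \<open>L\<close>, \<open>X\<close> and
  \<open>H\<close>.\<close>

lemma moment_bound_step:
  assumes g: "1 \<le> g" "moment_bound g" and d: "0 < d" "d < 1"
  shows "moment_bound (g + d)"
proof -
  obtain C1 where C1: "\<And>x. x \<noteq> 0 \<Longrightarrow> g * ln (norm (J 1 x)) \<le> C1 + (g - 1) * ln (norm x) + ln (norm (J g x))"
    using g by (auto simp: moment_bound_def)
  obtain C2 where C2: "\<And>x. x \<noteq> 0 \<Longrightarrow>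
      ln (norm (J (1 - d) x)) \<le> C2 + d * ln (norm x) + (1 - d) * ln (norm (J 1 x))"
    using moment_less_1[of "1 - d"] d by auto
  obtain C3 where C3: "\<And>x. x \<noteq> 0 \<Longrightarrow> ln (norm (J d x)) \<le> C3 + (1 - d) * ln (norm x) + d * ln (norm (J 1 x))"
    using moment_less_1[of d] d by auto
  define K where "K = (g * C2 + (1 - d) * C1 + (g - 1 + d) * C3) / (1 - d)"
  have "(g + d) * ln (norm (J 1 x)) \<le> K + (g + d - 1) * ln (norm x) + ln (norm (J (g + d) x))" if x: "x \<noteq> 0" for x
  proof -
    define X where "X = ln (norm x)"
    define L where "L = ln (norm (J 1 x))"
    define D where "D = ln (norm (J d x))"
    define E where "E = ln (norm (J (1 + d) x))"
    define H where "H = ln (norm (J (g + d) x))"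
    have y: "J d x \<noteq> 0" using J_inj[of d x] d x by auto
    have 1: "g * E \<le> C1 + (g - 1) * D + H"
      using C1[OF y] g d by (simp add: J_J E_def D_def H_def)
    have 2: "L \<le> C2 + d * D + (1 - d) * E"
      using C2[OF y] d by (simp add: J_J E_def D_def L_def)
    have 3: "D \<le> C3 + (1 - d) * X + d * L"
      using C3[OF x] by (simp add: D_def X_def L_def)
    have "g * L \<le> g * (C2 + d * D + (1 - d) * E)"
      using 2 g by (intro mult_left_mono) auto
    also have "\<dots> = g * C2 + g * d * D + (1 - d) * (g * E)"
      by (simp add: algebra_simps)
    also have "\<dots> \<le> g * C2 + g * d * D + (1 - d) * (C1 + (g - 1) * D + H)"
      using 1 d by (intro add_left_mono mult_left_mono) auto
    also have "\<dots> = g * C2 + (1 - d) * C1 + (1 - d) * H + (g - 1 + d) * D"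
      by (simp add: algebra_simps)
    also have "\<dots> \<le> g * C2 + (1 - d) * C1 + (1 - d) * H + (g - 1 + d) * (C3 + (1 - d) * X + d * L)"
      using 3 d g by (intro add_left_mono mult_left_mono) auto
    \<comment> \<open>The term \<open>(g - 1 + d) * (d * L)\<close> moves to the left, where the
      coefficient of \<open>L\<close> becomes g - (g - 1 + d) d = (1 - d) (g + d). Dividing by 1 - d
      explains \<open>K\<close>.\<close>
    finally have "(1 - d) * ((g + d) * L) \<le> (1 - d) * K + (1 - d) * ((g + d - 1) * X + H)"
      using d by (simp add: K_def) (simp add: algebra_simps)
    then have "(1 - d) * ((g + d) * L) \<le> (1 - d) * (K + (g + d - 1) * X + H)"
      by (simp add: algebra_simps)
    then have "(g + d) * L \<le> K + (g + d - 1) * X + H"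
      using d by (simp add: mult_le_cancel_left_pos)
    then show ?thesis by (simp add: L_def X_def H_def)
  qed
  then show ?thesis unfolding moment_bound_def by blast
qed

text \<open>From the trivial case of exponent 1, \<open>g\<close> is reached in \<open>m\<close>
  equal steps, with \<open>m\<close> large enough for each to be shorter than 1.\<close>

lemma moment_bound:
  assumes "1 \<le> g"
  shows "moment_bound g"
proof (cases "g = 1")
  case True
  then show ?thesis by (auto simp: moment_bound_def intro!: exI[of _ 0])
next
  case False
  with assms have g: "1 < g" by simp
  obtain m where m: "g - 1 < real m" using reals_Archimedean2 by blast
  define d where "d = (g - 1) / real m"
  have m0: "0 < real m" using m g by linarith
  have d: "0 < d" "d < 1" using m g m0 by (auto simp: d_def)
  have "moment_bound (1 + real k * d)" for k
  proof (induction k)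
    case 0
    show ?case by (auto simp: moment_bound_def intro!: exI[of _ 0])
  next
    case (Suc k)
    have "moment_bound (1 + real k * d + d)"
      using d by (intro moment_bound_step Suc) auto
    then show ?case by (simp add: algebra_simps)
  qed
  from this[of m] show ?thesis using m0 by (simp add: d_def)
qed

theorem moment_inequality:
  assumes "1 \<le> g"
  obtains C where "0 < C" "\<And>x. norm (J 1 x) powr g \<le> C * norm x powr (g - 1) * norm (J g x)"
proof -
  obtain C where C: "\<And>x. x \<noteq> 0 \<Longrightarrow> g * ln (norm (J 1 x)) \<le> C + (g - 1) * ln (norm x) + ln (norm (J g x))"
    using moment_bound[OF assms] by (auto simp: moment_bound_def)
  have "norm (J 1 x) powr g \<le> exp C * norm x powr (g - 1) * norm (J g x)" for x
  proof (cases "x = 0")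
    case True
    then show ?thesis by (simp add: linear_simps(3)[OF J_linear])
  next
    case False
    have pos: "0 < norm x" "0 < norm (J 1 x)" "0 < norm (J g x)"
      using False J1_inj[of x] J_inj[of g x] assms by auto
    have "norm (J 1 x) powr g = exp (g * ln (norm (J 1 x)))"
      using pos by (simp add: powr_def)
    also have "\<dots> \<le> exp (C + (g - 1) * ln (norm x) + ln (norm (J g x)))"
      using C[OF False] by simp
    also have "\<dots> = exp C * norm x powr (g - 1) * norm (J g x)"
      using pos by (simp add: exp_add powr_def)
    finally show ?thesis .
  qed
  then show thesis by (intro that[of "exp C"]) auto
qed

end

section \<open>The uniform boundedness principle\<close>

text \<open>Sokal's gliding hump: moving \<open>x\<close> by \<open>y\<close> or by \<open>- y\<close> makes \<open>norm (L x)\<close> at least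
  \<open>norm (L y)\<close>, so a series of such moves leads to a point where the family is unbounded.\<close>

lemma uniform_boundedness:
  fixes S :: "'i \<Rightarrow> 'a::banach \<Rightarrow> 'b::real_normed_vector"
  assumes lin: "\<And>i. i \<in> I \<Longrightarrow> bounded_linear (S i)"
    and bdd: "\<And>x. \<exists>B. \<forall>i\<in>I. norm (S i x) \<le> B"
  shows "\<exists>C. \<forall>i\<in>I. \<forall>x. norm (S i x) \<le> C * norm x"
proof (rule ccontr)
  assume neg: "\<not> ?thesis"
  \<comment> \<open>Steps of length 3^(-n) have a tail of half the current step, less than the share
    2/3 of the norm attained by \<open>y\<close>; norms of at least 4^n outgrow 3^n.\<close>
  have ex: "\<exists>i y. i \<in> I \<and> norm y = (1/3)^n \<and> 4^n \<le> onorm (S i) \<and> 2/3 * onorm (S i) * (1/3)^n \<le> norm (S i y)" for n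
  proof -
    have "\<exists>i\<in>I. 4^n < onorm (S i)"
    proof (rule ccontr)
      assume "\<not> (\<exists>i\<in>I. 4^n < onorm (S i))"
      then have "norm (S i x) \<le> 4^n * norm x" if "i \<in> I" for i x
        using onorm[OF lin[OF that], of x] that
        by (meson mult_right_mono norm_ge_zero not_le order_trans)
      with neg show False by blast
    qed
    then obtain i where i: "i \<in> I" "4^n < onorm (S i)" by blast
    have "0 < onorm (S i)" using i(2) by (meson less_trans zero_less_numeral zero_less_power)
    have "\<exists>z. 2/3 * onorm (S i) * norm z < norm (S i z)"
    proof (rule ccontr)
      assume "\<not> ?thesis"
      then have "onorm (S i) \<le> 2/3 * onorm (S i)"
        using \<open>0 < onorm (S i)\<close> by (intro onorm_bound) (auto simp: not_less)
      with \<open>0 < onorm (S i)\<close> show False by simp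
    qed
    then obtain z where z: "2/3 * onorm (S i) * norm z < norm (S i z)" by blast
    then have "z \<noteq> 0" by (auto simp: linear_simps(3)[OF lin[OF i(1)]])
    define c where "c = (1/3)^n / norm z"
    have c: "0 < c" "c * norm z = (1/3)^n" using \<open>z \<noteq> 0\<close> by (auto simp: c_def)
    have "2/3 * onorm (S i) * (1/3)^n = c * (2/3 * onorm (S i) * norm z)"
      using c(2) by (simp add: mult_ac)
    also have "\<dots> \<le> norm (S i (c *\<^sub>R z))"
      using c(1) z by (simp add: linear_simps(5)[OF lin[OF i(1)]] mult_left_mono)
    finally show ?thesis using i c by (intro exI[of _ i] exI[of _ "c *\<^sub>R z"]) auto
  qed
  obtain i y where i: "\<And>n. i n \<in> I" and y: "\<And>n. norm (y n) = (1/3)^n"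
    and big: "\<And>n. 4^n \<le> onorm (S (i n))"
    and near: "\<And>n. 2/3 * onorm (S (i n)) * (1/3)^n \<le> norm (S (i n) (y n))"
  proof -
    have "\<forall>n. \<exists>iy. fst iy \<in> I \<and> norm (snd iy) = (1/3)^n \<and> 4^n \<le> onorm (S (fst iy))
        \<and> 2/3 * onorm (S (fst iy)) * (1/3)^n \<le> norm (S (fst iy) (snd iy))"
      using ex by simp
    then obtain iy where iy: "\<And>n. fst (iy n) \<in> I \<and> norm (snd (iy n)) = (1/3)^n \<and> 4^n \<le> onorm (S (fst (iy n)))
        \<and> 2/3 * onorm (S (fst (iy n))) * (1/3)^n \<le> norm (S (fst (iy n)) (snd (iy n)))"
      by metis
    show thesis
      by (rule that[of "\<lambda>n. fst (iy n)" "\<lambda>n. snd (iy n)"]) (use iy in blast)+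
  qed
  define step where "step n z = (if norm (S (i n) (y n)) \<le> norm (S (i n) (z + y n)) then y n else - y n)" for n z
  define x where "x = rec_nat 0 (\<lambda>n z. z + step n z)"
  have x_Suc: "x (Suc n) = x n + step n (x n)" for n by (simp add: x_def)
  have hump: "norm (S (i n) (y n)) \<le> norm (S (i n) (x (Suc n)))" for n
  proof (cases "norm (S (i n) (y n)) \<le> norm (S (i n) (x n + y n))")
    case False
    note l = linear_simps[OF lin[OF i[of n]]]
    have "2 * norm (S (i n) (y n)) = norm (S (i n) (x n + y n) - S (i n) (x n - y n))"
      by (simp add: l(1,2) flip: scaleR_2)
    also have "\<dots> \<le> norm (S (i n) (x n + y n)) + norm (S (i n) (x n - y n))"
      by (rule norm_triangle_ineq4)
    finally show ?thesis using False by (simp add: x_Suc step_def)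
  qed (simp add: x_Suc step_def)
  define d where "d n = step n (x n)" for n
  have d: "norm (d n) \<le> (1/3)^n" for n by (simp add: d_def step_def y)
  have geo: "summable (\<lambda>n. (1/3)^n :: real)" by (rule summable_geometric) simp
  have sd: "summable d" by (rule summable_comparison_test'[OF geo, of 0]) (simp add: d)
  define X where "X = suminf d"
  have x_sum: "x n = sum d {..<n}" for n
    by (induction n) (simp_all add: x_Suc d_def, simp add: x_def)
  have dist: "norm (X - x (Suc n)) \<le> (1/3)^n / 2" for n
  proof -
    have "X - x (Suc n) = (\<Sum>k. d (k + Suc n))"
      unfolding X_def x_sum by (rule suminf_minus_initial_segment[OF sd, symmetric])
    also have "norm \<dots> \<le> (\<Sum>k. (1/3)^(k + Suc n))"
      by (rule norm_suminf_le[OF d]) (use geo in \<open>simp only: summable_iff_shift\<close>)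
    also have "\<dots> = (\<Sum>k. (1/3)^k) * (1/3)^Suc n"
      unfolding power_add by (rule suminf_mult2[OF geo, symmetric])
    also have "\<dots> = (1/3)^n / 2" by (simp add: suminf_geometric)
    finally show ?thesis .
  qed
  obtain B where B: "\<And>j. j \<in> I \<Longrightarrow> norm (S j X) \<le> B" using bdd by blast
  have "(4/3)^n \<le> 6 * B" for n
  proof -
    let ?N = "onorm (S (i n))"
    have N0: "0 \<le> ?N" by (rule onorm_pos_le[OF lin[OF i]])
    have "norm (S (i n) (X - x (Suc n))) \<le> ?N * norm (X - x (Suc n))"
      by (rule onorm[OF lin[OF i]])
    also have "\<dots> \<le> ?N * ((1/3)^n / 2)" by (rule mult_left_mono[OF dist N0])
    finally have "norm (S (i n) X - S (i n) (x (Suc n))) \<le> ?N * (1/3)^n / 2"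
      by (simp add: linear_simps(2)[OF lin[OF i]])
    moreover have "2/3 * (?N * (1/3)^n) \<le> norm (S (i n) (x (Suc n)))"
      using near[of n] hump[of n] by simp
    moreover have "norm (S (i n) (x (Suc n))) \<le> norm (S (i n) X) + norm (S (i n) X - S (i n) (x (Suc n)))"
      by (metis norm_minus_commute norm_triangle_sub)
    \<comment> \<open>The 6 is the inverse of 2/3 - 1/2.\<close>
    ultimately have "?N * (1/3)^n \<le> 6 * norm (S (i n) X)" by simp
    moreover have "4^n * (1/3)^n \<le> ?N * (1/3)^n" by (rule mult_right_mono[OF big]) simp
    moreover have "(4::real)^n * (1/3)^n = (4/3)^n" by (simp flip: power_mult_distrib)
    ultimately show ?thesis using B[OF i, of n] by simp
  qed
  moreover obtain n where "6 * B < (4/3)^n" using real_arch_pow[of "4/3" "6 * B"] by auto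
  ultimately show False by (meson not_le)
qed

section \<open>Decay of integrable orbits\<close>

context bounded_C0_semigroup
begin

lemma Lp_orbit_decay:
  assumes p: "1 \<le> p" and Lp: "in_Lp p (lebesgue_on {0<..}) (\<lambda>t. T t y)"
  obtains B where "\<And>t. 0 < t \<Longrightarrow> t powr (1 / p) * norm (T t y) \<le> B"
    and "((\<lambda>t. t powr (1 / p) * norm (T t y)) \<longlongrightarrow> 0) at_top"
proof -
  define N where "N = lebesgue_on {0::real<..}"
  define f where "f s = norm (T s y) powr p" for s
  have fi: "integrable N f" using Lp by (simp add: in_Lp_def N_def f_def[abs_def])
  have f0: "0 \<le> f s" for s by (simp add: f_def)
  have [measurable]: "{a<..b} \<in> sets N" if "0 \<le> a" for a b :: real
    using that by (auto simp: N_def sets_restrict_space_iff)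
  define tail where "tail t = (\<integral>s. indicator {t/2<..t} s * f s \<partial>N)" for t
  have m: "(\<lambda>s. indicator {t/2<..t} s * f s) \<in> borel_measurable N" for t
  proof -
    have "(\<lambda>s. indicator {t/2<..t} s :: real) \<in> borel_measurable N"
      unfolding N_def by (intro measurable_restrict_space1 borel_measurable_indicator) simp
    then show ?thesis using borel_measurable_integrable[OF fi] by (rule borel_measurable_times)
  qed
  have ti: "integrable N (\<lambda>s. indicator {t/2<..t} s * f s)" for t
    by (rule Bochner_Integration.integrable_bound[OF fi m]) (auto simp: f0 indicator_def)
  have tail_le: "tail t \<le> integral\<^sup>L N f" for t
    unfolding tail_def by (rule integral_mono[OF ti fi]) (auto simp: f0 indicator_def)
  have tail0: "0 \<le> tail t" for t
    unfolding tail_def by (rule integral_nonneg_AE) (auto simp: f0)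
  have "((\<lambda>t. \<integral>s. indicator {t/2<..t} s * f s \<partial>N) \<longlongrightarrow> (\<integral>s. 0 \<partial>N)) at_top"
  proof (rule integral_dominated_convergence_at_top[where w = f])
    show "AE s in N. ((\<lambda>t. indicator {t/2<..t} s * f s) \<longlongrightarrow> 0) at_top"
    proof (rule AE_I2, rule tendsto_eventually)
      fix s :: real
      show "\<forall>\<^sub>F t in at_top. indicator {t/2<..t} s * f s = 0"
        using eventually_ge_at_top[of "2 * s"] by eventually_elim (simp add: indicator_def)
    qed
    show "\<forall>\<^sub>F t in at_top. AE s in N. norm (indicator {t/2<..t} s * f s) \<le> f s"
      by (auto simp: f0 indicator_def)
  qed (use m fi in auto)
  then have tail_lim: "(tail \<longlongrightarrow> 0) at_top" by (simp add: tail_def[abs_def])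
  have key: "t powr (1 / p) * norm (T t y) \<le> M * (2 * tail t) powr (1 / p)" if t: "0 < t" for t
  proof -
    \<comment> \<open>A lower bound of \<open>f\<close> on all of [0, t], since T(t) y = T(t - s)
      T(s) y. It makes \<open>M * (t * c) powr (1 / p)\<close> equal to the quantity to be
      estimated.\<close>
    define c where "c = (norm (T t y) / M) powr p"
    have "c \<le> f s" if s: "0 \<le> s" "s \<le> t" for s
    proof -
      have "norm (T t y) \<le> M * norm (T s y)"
        using bound[of "t - s" "T s y"] T_add[of "t - s" s y] s by simp
      then have "norm (T t y) / M \<le> norm (T s y)" using M1 by (simp add: divide_simps mult.commute)
      then show ?thesis unfolding c_def f_def using p M1 by (intro powr_mono2) auto
    qed
    then have le: "indicator {t/2<..t} s * c \<le> indicator {t/2<..t} s * f s" for s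
      using t by (auto simp: indicator_def)
    have meas: "measure N {t/2<..t} = t / 2" "emeasure N {t/2<..t} < \<infinity>"
    proof -
      have "emeasure N {t/2<..t} = emeasure lebesgue {t/2<..t}"
        unfolding N_def using t by (intro emeasure_restrict_space) auto
      also have "\<dots> = emeasure lborel {t/2<..t}"
        using emeasure_completion[of "{t/2<..t}" lborel] main_part_sets[of "{t/2<..t}" lborel] by simp
      also have "\<dots> = ennreal (t / 2)"
        using t by simp
      finally show "measure N {t/2<..t} = t / 2" "emeasure N {t/2<..t} < \<infinity>"
        using t by (simp_all add: measure_def)
    qed
    have ci: "integrable N (\<lambda>s. indicator {t/2<..t} s * c)"
      using meas(2) t by (intro integrable_mult_left) simp
    have "t / 2 * c = (\<integral>s. indicator {t/2<..t} s * c \<partial>N)"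
      using meas t by simp
    also have "\<dots> \<le> tail t"
      unfolding tail_def by (rule integral_mono[OF ci ti]) (rule le)
    finally have "t * c \<le> 2 * tail t" by simp
    then have "(t * c) powr (1 / p) \<le> (2 * tail t) powr (1 / p)"
      using t p by (intro powr_mono2) (auto simp: c_def)
    then have "M * (t * c) powr (1 / p) \<le> M * (2 * tail t) powr (1 / p)"
      using M1 by (intro mult_left_mono) auto
    moreover have "M * (t * c) powr (1 / p) = t powr (1 / p) * norm (T t y)"
      using t p M1 by (simp add: c_def powr_mult powr_powr)
    ultimately show ?thesis by simp
  qed
  show thesis
  proof (rule that)
    show "t powr (1 / p) * norm (T t y) \<le> M * (2 * integral\<^sup>L N f) powr (1 / p)" if "0 < t" for t
      using tail_le[of t] tail0[of t] p M1
      by (intro order.trans[OF key[OF that]] mult_left_mono powr_mono2) auto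
    have "((\<lambda>t. (2 * tail t) powr (1 / p)) \<longlongrightarrow> 0) at_top"
      using tail_lim p tail0
      by (intro tendsto_zero_powrI[where b = "1 / p"] tendsto_eq_intros) auto
    then have lim: "((\<lambda>t. M * (2 * tail t) powr (1 / p)) \<longlongrightarrow> 0) at_top"
      using tendsto_mult_right_zero by blast
    show "((\<lambda>t. t powr (1 / p) * norm (T t y)) \<longlongrightarrow> 0) at_top"
    proof (rule tendsto_sandwich[OF _ _ tendsto_const lim])
      show "\<forall>\<^sub>F t in at_top. t powr (1 / p) * norm (T t y) \<le> M * (2 * tail t) powr (1 / p)"
        using eventually_gt_at_top[of 0] by eventually_elim (rule key)
    qed simp
  qed
qed

section \<open>Decay rates of \<open>T t (J \<beta> x)\<close> and
  \<open>T t (J 1 x)\<close>\<close>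

context
  fixes p \<beta> :: real
  assumes p: "1 \<le> p" and \<beta>: "0 < \<beta>"
    and Lp: "\<And>x. in_Lp p (lebesgue_on {0<..}) (\<lambda>t. T t (J \<beta> x))"
begin

lemma T_J_bound:
  obtains C where "0 < C" "\<And>t x. 0 < t \<Longrightarrow> norm (T t (J \<beta> x)) \<le> C * t powr (- (1 / p)) * norm x"
proof -
  have "\<exists>C. \<forall>t\<in>{0<..}. \<forall>x. norm (t powr (1 / p) *\<^sub>R T t (J \<beta> x)) \<le> C * norm x"
  proof (rule uniform_boundedness[where S = "\<lambda>t x. t powr (1 / p) *\<^sub>R T t (J \<beta> x)"])
    show "bounded_linear (\<lambda>x. t powr (1 / p) *\<^sub>R T t (J \<beta> x))" if "t \<in> {0<..}" for t
      using that
      by (intro bounded_linear_compose[OF bounded_linear_scaleR_right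
          bounded_linear_compose[OF T_linear J_linear[OF \<beta>]]]) simp
    show "\<exists>B. \<forall>t\<in>{0<..}. norm (t powr (1 / p) *\<^sub>R T t (J \<beta> x)) \<le> B" for x
    proof -
      obtain B where "\<And>t. 0 < t \<Longrightarrow> t powr (1 / p) * norm (T t (J \<beta> x)) \<le> B"
        using Lp_orbit_decay[OF p Lp[of x]] by blast
      then show ?thesis by (intro exI[of _ B]) simp
    qed
  qed
  then obtain C where C: "\<And>t x. 0 < t \<Longrightarrow> t powr (1 / p) * norm (T t (J \<beta> x)) \<le> C * norm x"
    by auto
  \<comment> \<open>\<open>max C 1\<close> serves to make the constant positive.\<close>
  have "norm (T t (J \<beta> x)) \<le> max C 1 * t powr (- (1 / p)) * norm x" if t: "0 < t" for t x
  proof -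
    have "t powr (1 / p) * norm (T t (J \<beta> x)) \<le> max C 1 * norm x"
      by (rule order.trans[OF C[OF t]]) (simp add: mult_right_mono)
    then show ?thesis using t by (simp add: powr_minus divide_simps mult_ac)
  qed
  then show thesis by (intro that[of "max C 1"]) auto
qed

text \<open>Of the \<open>Suc m\<close> factors only \<open>m\<close> are replaced by the uniform
  bound; the one left on \<open>x\<close> preserves convergence to zero along a single
  orbit.\<close>

lemma T_J_power_bound:
  assumes C: "0 < C" "\<And>t x. 0 < t \<Longrightarrow> norm (T t (J \<beta> x)) \<le> C * t powr (- (1 / p)) * norm x"
    and t: "0 < t"
  shows "norm (T (real (Suc m) * t) (J (real (Suc m) * \<beta>) x)) \<le> (C * t powr (- (1 / p))) ^ m * norm (T t (J \<beta> x))"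
proof (induction m)
  case (Suc m)
  define n where "n = real (Suc m)"
  have n: "0 < n" by (simp add: n_def)
  have "T (real (Suc (Suc m)) * t) (J (real (Suc (Suc m)) * \<beta>) x) = T t (J \<beta> (T (n * t) (J (n * \<beta>) x)))"
  proof -
    have "real (Suc (Suc m)) = 1 + n" by (simp add: n_def)
    then have "T (real (Suc (Suc m)) * t) (J (real (Suc (Suc m)) * \<beta>) x) = T (t + n * t) (J (\<beta> + n * \<beta>) x)"
      by (simp add: distrib_right)
    also have "\<dots> = T t (T (n * t) (J \<beta> (J (n * \<beta>) x)))"
      using t n \<beta> by (simp add: T_add J_J)
    finally show ?thesis using t n \<beta> by (simp add: T_J)
  qed
  also have "norm \<dots> \<le> C * t powr (- (1 / p)) * norm (T (n * t) (J (n * \<beta>) x))"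
    by (rule C(2)[OF t])
  also have "\<dots> \<le> C * t powr (- (1 / p)) * ((C * t powr (- (1 / p))) ^ m * norm (T t (J \<beta> x)))"
    using C(1) Suc.IH by (intro mult_left_mono) (auto simp: n_def)
  finally show ?case by (simp add: mult.assoc)
qed simp

text \<open>One estimate for both conclusions: the inner factor \<open>(\<tau> / n) powr (1 / p) *
  norm (T (\<tau> / n) (J \<beta> x))\<close> is bounded by a multiple of \<open>norm x\<close>, and
  for fixed \<open>x\<close> it tends to zero. The exponent arises from n / (p g) = 1 / (p
  \<beta>).\<close>

lemma T_J1_estimate:
  obtains K n g where "0 < K" "0 < n" "0 < g"
    "\<And>\<tau> x. 0 < \<tau> \<Longrightarrow> \<tau> powr (1 / (p * \<beta>)) * norm (T \<tau> (J 1 x))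
        \<le> K * (norm x powr (g - 1) * ((\<tau> / n) powr (1 / p) * norm (T (\<tau> / n) (J \<beta> x)))) powr (1 / g)"
proof -
  obtain C where C: "0 < C" "\<And>t x. 0 < t \<Longrightarrow> norm (T t (J \<beta> x)) \<le> C * t powr (- (1 / p)) * norm x"
    using T_J_bound by blast
  obtain m where m: "1 / \<beta> < real (Suc m)"
    using reals_Archimedean2[of "1 / \<beta>"] by (metis less_trans lessI of_nat_less_iff)
  define n where "n = real (Suc m)"
  define g where "g = n * \<beta>"
  have n: "0 < n" by (simp add: n_def)
  have g: "1 \<le> g" using m \<beta> by (simp add: g_def n_def field_simps)
  obtain K where K: "0 < K" "\<And>x. norm (J 1 x) powr g \<le> K * norm x powr (g - 1) * norm (J g x)"
    using moment_inequality[OF g] by blast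
  define L where "L = K * M powr (g - 1) * C ^ m"
  have L: "0 < L" using K C M1 by (simp add: L_def)
  have est: "\<tau> powr (1 / (p * \<beta>)) * norm (T \<tau> (J 1 x))
      \<le> (n powr (1 / (p * \<beta>)) * L powr (1 / g)) * (norm x powr (g - 1) * ((\<tau> / n) powr (1 / p) * norm (T (\<tau> / n) (J \<beta> x)))) powr (1 / g)"
    if \<tau>: "0 < \<tau>" for \<tau> x
  proof -
    define t where "t = \<tau> / n"
    have t: "0 < t" "\<tau> = n * t" using n \<tau> by (auto simp: t_def)
    define w where "w = norm (T t (J \<beta> x))"
    \<comment> \<open>Multiplying by t^(n/p) overcompensates the m = n - 1 uniform factors by
      t^(1/p), just what the remaining factor needs.\<close>
    have pw: "(t powr (- (1 / p))) ^ m * t powr (n / p) = t powr (1 / p)"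
    proof -
      have "(t powr (- (1 / p))) ^ m = t powr (- (1 / p) * real m)"
        using t by (subst powr_powr[symmetric], subst powr_realpow) auto
      moreover have "- (1 / p) * real m + n / p = 1 / p"
        by (simp add: n_def diff_divide_distrib[symmetric] add_divide_distrib)
      ultimately show ?thesis by (simp flip: powr_add)
    qed
    \<comment> \<open>The moment inequality is applied to T(\<tau>) x, which commutes with all
      \<open>J a\<close>.\<close>
    have "norm (T \<tau> (J 1 x)) powr g = norm (J 1 (T \<tau> x)) powr g"
      using \<tau> by (simp add: T_J)
    also have "\<dots> \<le> K * norm (T \<tau> x) powr (g - 1) * norm (J g (T \<tau> x))"
      by (rule K(2))
    also have "\<dots> \<le> K * (M * norm x) powr (g - 1) * norm (J g (T \<tau> x))"
      using K g \<tau> bound[of \<tau> x] by (intro mult_right_mono mult_left_mono powr_mono2) auto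
    also have "J g (T \<tau> x) = T (real (Suc m) * t) (J (real (Suc m) * \<beta>) x)"
      using \<tau> g t by (simp add: T_J g_def n_def)
    also have "K * (M * norm x) powr (g - 1) * norm \<dots>
        \<le> K * (M * norm x) powr (g - 1) * ((C * t powr (- (1 / p))) ^ m * w)"
      unfolding w_def using K by (intro mult_left_mono T_J_power_bound[OF C t(1)]) auto
    also have "\<dots> = L * norm x powr (g - 1) * ((t powr (- (1 / p))) ^ m * w)"
      using M1 by (simp add: L_def powr_mult power_mult_distrib mult_ac)
    finally have "norm (T \<tau> (J 1 x)) powr g * t powr (n / p)
        \<le> L * norm x powr (g - 1) * ((t powr (- (1 / p))) ^ m * w) * t powr (n / p)"
      by (rule mult_right_mono) simp
    also have "\<dots> = L * (norm x powr (g - 1) * (t powr (1 / p) * w))"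
      unfolding pw[symmetric] by (simp add: mult_ac)
    finally have "(norm (T \<tau> (J 1 x)) powr g * t powr (n / p)) powr (1 / g)
        \<le> (L * (norm x powr (g - 1) * (t powr (1 / p) * w))) powr (1 / g)"
      using g by (intro powr_mono2) auto
    moreover have "(norm (T \<tau> (J 1 x)) powr g * t powr (n / p)) powr (1 / g) = norm (T \<tau> (J 1 x)) * t powr (1 / (p * \<beta>))"
      using g n p \<beta> by (simp add: powr_mult powr_powr g_def)
    moreover have "(L * (norm x powr (g - 1) * (t powr (1 / p) * w))) powr (1 / g)
        = L powr (1 / g) * (norm x powr (g - 1) * (t powr (1 / p) * w)) powr (1 / g)"
      using L by (simp add: powr_mult w_def)
    ultimately have "n powr (1 / (p * \<beta>)) * (norm (T \<tau> (J 1 x)) * t powr (1 / (p * \<beta>)))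
        \<le> n powr (1 / (p * \<beta>)) * (L powr (1 / g) * (norm x powr (g - 1) * (t powr (1 / p) * w)) powr (1 / g))"
      by (intro mult_left_mono) auto
    moreover have "n powr (1 / (p * \<beta>)) * t powr (1 / (p * \<beta>)) = \<tau> powr (1 / (p * \<beta>))"
      using n t by (simp add: powr_mult)
    ultimately show ?thesis
      unfolding t_def[symmetric] w_def[symmetric] by (simp add: mult_ac)
  qed
  show thesis
    by (rule that[OF _ n _ est]) (use n L g in auto)
qed

lemma T_J1_bound:
  obtains K where "0 < K" "\<And>t x. 0 < t \<Longrightarrow> norm (T t (J 1 x)) \<le> K * t powr (- (1 / (p * \<beta>))) * norm x"
proof -
  obtain K n g where K: "0 < K" "0 < n" "0 < g"
    and est: "\<And>\<tau> x. 0 < \<tau> \<Longrightarrow> \<tau> powr (1 / (p * \<beta>)) * norm (T \<tau> (J 1 x))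
        \<le> K * (norm x powr (g - 1) * ((\<tau> / n) powr (1 / p) * norm (T (\<tau> / n) (J \<beta> x)))) powr (1 / g)"
    using T_J1_estimate by blast
  obtain C where C: "0 < C" "\<And>t x. 0 < t \<Longrightarrow> norm (T t (J \<beta> x)) \<le> C * t powr (- (1 / p)) * norm x"
    using T_J_bound by blast
  have "norm (T t (J 1 x)) \<le> K * C powr (1 / g) * t powr (- (1 / (p * \<beta>))) * norm x" if t: "0 < t" for t x
  proof -
    have "(t / n) powr (1 / p) * norm (T (t / n) (J \<beta> x)) \<le> C * norm x"
      using C(2)[of "t / n" x] t K(2) by (simp add: powr_minus divide_simps mult_ac)
    then have "norm x powr (g - 1) * ((t / n) powr (1 / p) * norm (T (t / n) (J \<beta> x))) \<le> norm x powr (g - 1) * (C * norm x)"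
      by (rule mult_left_mono) simp
    also have "\<dots> = C * norm x powr g"
      by (cases "norm x = 0") (auto simp: powr_mult_base powr_diff)
    finally have "t powr (1 / (p * \<beta>)) * norm (T t (J 1 x)) \<le> K * (C * norm x powr g) powr (1 / g)"
      using K by (intro order.trans[OF est[OF t]] mult_left_mono powr_mono2) auto
    also have "\<dots> = K * C powr (1 / g) * norm x"
      using K C by (simp add: powr_mult powr_powr)
    finally show ?thesis using t by (simp add: powr_minus divide_simps mult_ac)
  qed
  then show thesis using K C by (intro that[of "K * C powr (1 / g)"]) auto
qed

lemma T_J1_tendsto_0: "((\<lambda>t. t powr (1 / (p * \<beta>)) * norm (T t (J 1 x))) \<longlongrightarrow> 0) at_top"
proof -
  obtain K n g where K: "0 < K" "0 < n" "0 < g"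
    and est: "\<And>\<tau> x. 0 < \<tau> \<Longrightarrow> \<tau> powr (1 / (p * \<beta>)) * norm (T \<tau> (J 1 x))
        \<le> K * (norm x powr (g - 1) * ((\<tau> / n) powr (1 / p) * norm (T (\<tau> / n) (J \<beta> x)))) powr (1 / g)"
    using T_J1_estimate by blast
  define h where "h t = t powr (1 / p) * norm (T t (J \<beta> x))" for t
  have "(h \<longlongrightarrow> 0) at_top"
    unfolding h_def using Lp_orbit_decay[OF p Lp[of x]] by metis
  moreover have "filterlim (\<lambda>t. t / n) at_top at_top"
    using K(2) filterlim_tendsto_pos_mult_at_top[OF tendsto_const _ filterlim_ident, of "1 / n"] by simp
  ultimately have "((\<lambda>t. h (t / n)) \<longlongrightarrow> 0) at_top" by (rule filterlim_compose)
  then have "((\<lambda>t. norm x powr (g - 1) * h (t / n)) \<longlongrightarrow> 0) at_top"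
    by (rule tendsto_mult_right_zero)
  then have "((\<lambda>t. (norm x powr (g - 1) * h (t / n)) powr (1 / g)) \<longlongrightarrow> 0) at_top"
    using K(3) by (intro tendsto_zero_powrI[where b = "1 / g"]) (auto simp: h_def)
  then have lim: "((\<lambda>t. K * (norm x powr (g - 1) * h (t / n)) powr (1 / g)) \<longlongrightarrow> 0) at_top"
    by (rule tendsto_mult_right_zero)
  have ev: "\<forall>\<^sub>F t in at_top. t powr (1 / (p * \<beta>)) * norm (T t (J 1 x)) \<le> K * (norm x powr (g - 1) * h (t / n)) powr (1 / g)"
    using eventually_gt_at_top[of 0] by eventually_elim (simp add: est h_def)
  show ?thesis
    by (rule tendsto_sandwich[OF _ ev tendsto_const lim]) simp
qed

end

end

theorem theorem2p1:
  fixes T :: "real \<Rightarrow> 'a::complex_banach \<Rightarrow> 'a" and p \<beta> :: real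
  assumes "C0_semigroup T" and "bounded_semigroup T"
    and "1 \<le> p" and "0 < \<beta>"
    and "\<forall>x \<in> frac_power_domain T \<beta>. in_Lp p (lebesgue_on {0<..}) (\<lambda>t. T t x)"
  shows "range (\<lambda>s::real. \<i> * complex_of_real s) \<subseteq> resolvent_set (gen_domain T) (generator T)
    \<and> (\<lambda>t. onorm (\<lambda>x. T t (inv_into (gen_domain T) (generator T) x)))
        \<in> O[at_top](\<lambda>t. t powr (- 1 / (p * \<beta>)))
    \<and> (is_hilbert_space TYPE('a) \<longrightarrow>
        (\<forall>x \<in> gen_domain T. (\<lambda>t. norm (T t x)) \<in> o[at_top](\<lambda>t. t powr (- 1 / (p * \<beta>)))))"
proof -
  obtain B where B: "\<And>t. 0 \<le> t \<Longrightarrow> onorm (T t) \<le> B"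
    using assms(2) by (auto simp: bounded_semigroup_def bdd_above_def)
  interpret bounded_C0_semigroup T "max 1 B"
  proof
    fix t :: real and x assume t: "0 \<le> t"
    have "norm (T t x) \<le> onorm (T t) * norm x"
      using assms(1) t by (intro onorm) (auto simp: C0_semigroup_def bounded_clinear_def)
    also have "\<dots> \<le> max 1 B * norm x"
      using B[OF t] by (intro mult_right_mono) auto
    finally show "norm (T t x) \<le> max 1 B * norm x" .
  qed (use assms(1) in auto)
  have Lp: "in_Lp p (lebesgue_on {0<..}) (\<lambda>t. T t (J \<beta> x))" for x
    using assms(5) by (simp add: frac_power_domain_def J_eq)
  define \<gamma> where "\<gamma> = 1 / (p * \<beta>)"
  have \<gamma>: "0 < \<gamma>" "- 1 / (p * \<beta>) = - \<gamma>" using assms(3,4) by (auto simp: \<gamma>_def)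
  obtain K where K: "0 < K" "\<And>t x. 0 < t \<Longrightarrow> norm (T t (J 1 x)) \<le> K * t powr (- \<gamma>) * norm x"
    using T_J1_bound[OF assms(3,4) Lp] unfolding \<gamma>_def by blast
  have spec: "\<i> * complex_of_real s \<in> resolvent_set (gen_domain T) (generator T)" for s
  proof -
    have "((\<lambda>t::real. cmod (1 - \<i> * complex_of_real s) * (K * t powr (- \<gamma>))) \<longlongrightarrow> 0) at_top"
      using \<gamma>(1) by (intro tendsto_mult_right_zero tendsto_neg_powr filterlim_ident) auto
    then have "\<forall>\<^sub>F t in at_top. cmod (1 - \<i> * complex_of_real s) * (K * t powr (- \<gamma>)) < 1"
      by (rule order_tendstoD) simp
    then have "\<forall>\<^sub>F t in at_top. 0 < t \<and> cmod (1 - \<i> * complex_of_real s) * (K * t powr (- \<gamma>)) < 1"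
      using eventually_gt_at_top[of 0] by eventually_elim simp
    then obtain t where t: "0 < t" "cmod (1 - \<i> * complex_of_real s) * (K * t powr (- \<gamma>)) < 1"
      by (auto simp: eventually_at_top_linorder)
    \<comment> \<open>A single time \<open>t\<close>, depending on \<open>s\<close>, is enough for
      the contraction.\<close>
    show ?thesis
      using t K by (intro imaginary_in_resolvent_set[of t "K * t powr (- \<gamma>)"]) auto
  qed
  let ?D = "gen_domain T" and ?A = "generator T"
  \<comment> \<open>The resolvent at 0, written as \<open>resolvent_set\<close> has it. It inverts
    -A, so A^(-1) z is \<open>R (- z)\<close>.\<close>
  define R where "R = inv_into ?D (\<lambda>x. 0 *\<^sub>C x - ?A x)"
  have zero: "0 *\<^sub>C x = (0 :: 'a)" for x
    using scaleR_scaleC[of 0 x] by simp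
  have R: "bij_betw (\<lambda>x. - ?A x) ?D UNIV" "bounded_linear R"
    using spec[of 0] by (auto simp: resolvent_set_def R_def bounded_clinear_def zero)
  have inv: "inv_into ?D ?A z = R (- z)" "R z \<in> ?D" "?A (R (- z)) = z" for z
  proof -
    have "- ?A (R z) = z" "R z \<in> ?D" for z
      using bij_betw_inv_into_right[OF R(1), of z] bij_betw_imp_surj_on[OF bij_betw_inv_into[OF R(1)]]
      by (auto simp: R_def zero)
    then show A: "?A (R (- z)) = z" and D: "R z \<in> ?D" for z
      by (metis minus_minus)+
    have "inj_on ?A ?D"
      using bij_betw_imp_inj_on[OF R(1)] by (auto simp: inj_on_def)
    then show "inv_into ?D ?A z = R (- z)"
      using inv_into_f_f[of ?A ?D "R (- z)"] A D by simp
  qed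
  obtain N where N: "0 < N" "\<And>z. norm (R z) \<le> norm z * N"
    using bounded_linear.pos_bounded[OF R(2)] by blast
  have lin: "bounded_linear (\<lambda>z. T t (R (- z)))" if "0 \<le> t" for t
    by (intro bounded_linear_compose[OF T_linear[OF that]] bounded_linear_compose[OF R(2)]
        bounded_linear_minus bounded_linear_ident)
  have "onorm (\<lambda>x. T t (inv_into ?D ?A x)) \<le> K * (N + 1) * t powr (- \<gamma>)" if t: "0 < t" for t
  proof (rule onorm_bound)
    fix z
    define w where "w = R (- z)"
    \<comment> \<open>Here z = A w, so A^(-1) z = w = J_1 (w - z) factors through J_1; the constant
      \<open>N + 1\<close> bounds the map from z to w - z.\<close>
    have "J 1 z = J 1 w - w"
      using J1_gen[OF gen_generator, of w] inv(2,3) by (simp add: w_def)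
    then have "w = J 1 (w - z)" by (simp add: linear_simps(2)[OF J_linear])
    then have "norm (T t w) \<le> K * t powr (- \<gamma>) * norm (w - z)" using K(2)[OF t] by metis
    also have "\<dots> \<le> K * t powr (- \<gamma>) * ((N + 1) * norm z)"
      using norm_triangle_ineq4[of w z] N(2)[of "- z"] K(1)
      by (intro mult_left_mono) (auto simp: w_def algebra_simps)
    finally show "norm (T t (inv_into ?D ?A z)) \<le> K * (N + 1) * t powr (- \<gamma>) * norm z"
      by (simp add: inv(1) w_def mult_ac)
  qed (use K N in auto)
  then have "(\<lambda>t. onorm (\<lambda>x. T t (inv_into ?D ?A x))) \<in> O[at_top](\<lambda>t. t powr (- \<gamma>))"
    using onorm_pos_le[OF lin]
    by (intro bigoI[of _ "K * (N + 1)"] eventually_mono[OF eventually_gt_at_top[of 0]])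
      (simp add: inv(1) less_imp_le)
  moreover have "(\<lambda>t. norm (T t x)) \<in> o[at_top](\<lambda>t. t powr (- \<gamma>))" if x: "x \<in> ?D" for x
  proof (rule smalloI_tendsto)
    have "x = J 1 (x - ?A x)"
      using J1_gen[OF gen_generator[OF x]] by (simp add: linear_simps(2)[OF J_linear])
    then have "((\<lambda>t. t powr \<gamma> * norm (T t x)) \<longlongrightarrow> 0) at_top"
      using T_J1_tendsto_0[OF assms(3,4) Lp, of "x - ?A x"] by (simp add: \<gamma>_def)
    then show "((\<lambda>t. norm (T t x) / t powr (- \<gamma>)) \<longlongrightarrow> 0) at_top"
      by (simp add: powr_minus divide_inverse mult.commute)
    show "\<forall>\<^sub>F t in at_top. t powr (- \<gamma>) \<noteq> 0"
      using eventually_gt_at_top[of 0] by eventually_elim simp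
  qed
  ultimately show ?thesis
    using spec unfolding \<gamma>(2) by blast
qed

end
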